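(* Let $\mathbf P$ be an irreducible $s\times s$ stochastic matrix, $\mathcal U\subset\mathbb R^{s\times s}$ an open neighbourhood of $\mathbf P$, and let $\Phi:\mathcal U\to\mathbb R^{q\times r}$ be Fréchet differentiable at $\mathbf P$ with derivative $\Phi'_{\mathbf P}$. Suppose that there is a matrix $\mathbf L_\Phi\in\mathbb R^{qr\times s^2}$ such that $$\operatorname{vec}\{\Phi'_{\mathbf P}(\mathbf H)^\top\}=\mathbf L_\Phi\operatorname{vec}(\mathbf H^\top),\qquad \mathbf H\in\mathbb R^{s\times s}.$$ Then, with $\mathbf W$, $\mathbf W_{\mathbf p}$ and $\mathbf\Sigma_{\mathbf p}$ as in the context, $$\operatorname{vec}\{\Phi'_{\mathbf P}(\mathbf W)^\top\}=\mathbf L_\Phi\mathbf W_{\mathbf p},\qquad \operatorname{Cov}\left[\operatorname{vec}\{\Phi'_{\mathbf P}(\mathbf W)^\top\}\right]=\mathbf L_\Phi\mathbf\Sigma_{\mathbf p}\mathbf L_\Phi^\top.$$ If $\Phi'_{\mathbf P}(\mathbf H)=\sum_{\ell=1}^{m}\mathbf B_\ell\mathbf H\mathbf A_\ell$ for fixed matrices $\mathbf B_\ell\in\mathbb R^{q\times s}$ and $\mathbf A_\ell\in\mathbb R^{s\times r}$, then $$\mathbf L_\Phi=\sum_{\ell=1}^{m}\mathbf B_\ell\otimes\mathbf A_\ell^\top.$$ Finally, for a scalar characteristic $\phi(\mathbf P)=\mathbf a\Phi(\mathbf P)\mathbf c$ with fixed $\mathbf a\in\mathbb R^{1\times q}$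 and $\mathbf c\in\mathbb R^{r\times1}$, the limit in distribution of $\sqrt n\{\phi(\widehat{\mathbf P}(n))-\phi(\mathbf P)\}$ is $\mathbf a\Phi'_{\mathbf P}(\mathbf W)\mathbf c$, with variance $$\sigma_\phi^2=(\mathbf a\otimes\mathbf c^\top)\mathbf L_\Phi\mathbf\Sigma_{\mathbf p}\mathbf L_\Phi^\top(\mathbf a^\top\otimes\mathbf c).$$
   Context: $(X_m)_{m\ge0}$ is a time-homogeneous Markov chain on $\{1,\ldots,s\}$ with irreducible transition matrix $\mathbf P=(p_{ij})$ and stationary row vector $\boldsymbol\pi=(\pi_1,\ldots,\pi_s)$, observed along a single trajectory $X_0,\ldots,X_n$. $N_{ij}(n)$ is the number of transitions from $i$ to $j$ up to time $n$, $N_i(n)=\sum_jN_{ij}(n)$, and $\widehat{\mathbf P}(n)$ has entries $N_{ij}(n)/N_i(n)$ (and $0$ if $N_i(n)=0$). Limits are as $n\to\infty$. Plug-in quantities may be defined arbitrarily when $\widehat{\mathbf P}(n)$ is outside the domain of the functional or is not stochastic. $\mathbf W=(W_{ij})$ is the centered Gaussian random $s\times s$ matrix with $\operatorname{Cov}(W_{ij},W_{kl})=\delta_{ik}\pi_i^{-1}p_{ij}(\delta_{jl}-p_{il})$. $\operatorname{vec}$ stacks columns, $\mathbf W_{\mathbf p}=\operatorname{vec}(\mathbf W^\top)$, and $\mathbf\Sigma_{\mathbf p}=\operatorname{Cov}(\mathbf W_{\mathbf p})$, i.e. the $s^2\times s^2$ block diagonal matrix with blocks $\pi_i^{-1}\mathbf\Lambda_i$,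 $\mathbf\Lambda_i(j,k)=p_{ij}(\delta_{jk}-p_{ik})$, $i=1,\ldots,s$. $\otimes$ is the Kronecker product. *)

theory Defs
  imports "HOL-Probability.Probability"
begin

definition stochastic_matrix :: "real^'s^'s \<Rightarrow> bool" where
  "stochastic_matrix P \<longleftrightarrow> (\<forall>i j. 0 \<le> P $ i $ j) \<and> (\<forall>i. (\<Sum>j\<in>UNIV. P $ i $ j) = 1)"

primrec matrix_power :: "real^'s^'s \<Rightarrow> nat \<Rightarrow> real^'s^'s" where
  "matrix_power A 0 = mat 1"
| "matrix_power A (Suc n) = matrix_power A n ** A"

definition irreducible_matrix :: "real^'s^'s \<Rightarrow> bool" where
  "irreducible_matrix P \<longleftrightarrow> (\<forall>i j. \<exists>n. 0 < matrix_power P n $ i $ j)"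

definition stationary_vector :: "real^'s^'s \<Rightarrow> real^'s \<Rightarrow> bool" where
  "stationary_vector P \<pi> \<longleftrightarrow>
     (\<forall>i. 0 \<le> \<pi> $ i) \<and> (\<Sum>i\<in>UNIV. \<pi> $ i) = 1 \<and> \<pi> v* P = \<pi>"

text \<open>The initial distribution is arbitrary.\<close>

definition markov_chain :: "'a measure \<Rightarrow> real^'s^'s \<Rightarrow> (nat \<Rightarrow> 'a \<Rightarrow> 's) \<Rightarrow> bool" where
  "markov_chain M P X \<longleftrightarrow>
     prob_space M \<and>
     (\<forall>n. X n \<in> measurable M (count_space UNIV)) \<and>
     (\<forall>n x j. \<P>(\<omega> in M. \<forall>k\<le>n. X k \<omega> = x k) > 0 \<longrightarrow>
        \<P>(\<omega> in M. X (Suc n) \<omega> = j \<bar> \<forall>k\<le>n. X k \<omega> = x k) = P $ x n $ j)"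

definition transition_count :: "(nat \<Rightarrow> 'a \<Rightarrow> 's) \<Rightarrow> nat \<Rightarrow> 'a \<Rightarrow> 's \<Rightarrow> 's \<Rightarrow> nat" where
  "transition_count X n \<omega> i j = card {m. m < n \<and> X m \<omega> = i \<and> X (Suc m) \<omega> = j}"

definition visit_count :: "(nat \<Rightarrow> 'a \<Rightarrow> 's::finite) \<Rightarrow> nat \<Rightarrow> 'a \<Rightarrow> 's \<Rightarrow> nat" where
  "visit_count X n \<omega> i = (\<Sum>j\<in>UNIV. transition_count X n \<omega> i j)"

definition P_hat :: "(nat \<Rightarrow> 'a \<Rightarrow> 's::finite) \<Rightarrow> nat \<Rightarrow> 'a \<Rightarrow> real^'s^'s" where
  "P_hat X n \<omega> = (\<chi> i j. if visit_count X n \<omega> i = 0 then 0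
     else real (transition_count X n \<omega> i j) / real (visit_count X n \<omega> i))"

text \<open>Column stacking. A vector of length \<open>n * m\<close> is indexed by pairs, and the pair
  (column, row), read lexicographically, is the position in the stacked vector.\<close>

definition vec_of :: "real^'n^'m \<Rightarrow> real^('n \<times> 'm)" where
  "vec_of A = (\<chi> p. A $ snd p $ fst p)"

text \<open>Rows and columns of a Kronecker product are indexed by pairs, again in
  lexicographic order.\<close>

definition kronecker :: "real^'n^'m \<Rightarrow> real^'l^'k \<Rightarrow> real^('n \<times> 'l)^('m \<times> 'k)" where
  "kronecker A B = (\<chi> p q. A $ fst p $ fst q * B $ snd p $ snd q)"

definition covariance :: "'b measure \<Rightarrow> ('b \<Rightarrow> real) \<Rightarrow> ('b \<Rightarrow> real) \<Rightarrow> real" where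
  "covariance N Y Z = (\<integral>\<omega>. (Y \<omega> - (\<integral>\<eta>. Y \<eta> \<partial>N)) * (Z \<omega> - (\<integral>\<eta>. Z \<eta> \<partial>N)) \<partial>N)"

definition covariance_matrix :: "'b measure \<Rightarrow> ('b \<Rightarrow> real^'n) \<Rightarrow> real^'n^'n" where
  "covariance_matrix N Y = (\<chi> a b. covariance N (\<lambda>\<omega>. Y \<omega> $ a) (\<lambda>\<omega>. Y \<omega> $ b))"

text \<open>Degenerate normal laws are point masses; \<open>normal_density\<close> with standard deviation 0
  is not a density.\<close>

definition gaussian_law :: "real \<Rightarrow> real \<Rightarrow> real measure" where
  "gaussian_law \<mu> \<sigma> =
     (if \<sigma> = 0 then return borel \<mu> else density lborel (\<lambda>x. ennreal (normal_density \<mu> \<sigma> x)))"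

text \<open>Joint normality: every linear functional is normal, possibly degenerate. On matrices
  the inner product is the sum of the entrywise products.\<close>

definition gaussian_element :: "'b measure \<Rightarrow> ('b \<Rightarrow> 'v::euclidean_space) \<Rightarrow> bool" where
  "gaussian_element N W \<longleftrightarrow>
     prob_space N \<and> W \<in> borel_measurable N \<and>
     (\<forall>u. \<exists>\<mu> \<sigma>. 0 \<le> \<sigma> \<and> distr N borel (\<lambda>\<omega>. u \<bullet> W \<omega>) = gaussian_law \<mu> \<sigma>)"

definition limit_gaussian_matrix ::
    "'b measure \<Rightarrow> real^'s^'s \<Rightarrow> real^'s \<Rightarrow> ('b \<Rightarrow> real^'s^'s) \<Rightarrow> bool" where
  "limit_gaussian_matrix N P \<pi> W \<longleftrightarrow>
     gaussian_element N W \<and>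
     (\<forall>i j. (\<integral>\<omega>. W \<omega> $ i $ j \<partial>N) = 0) \<and>
     (\<forall>i j k l. covariance N (\<lambda>\<omega>. W \<omega> $ i $ j) (\<lambda>\<omega>. W \<omega> $ k $ l) =
        (if i = k then inverse (\<pi> $ i) * P $ i $ j * ((if j = l then 1 else 0) - P $ i $ l) else 0))"

definition W_p :: "('b \<Rightarrow> real^'s^'s) \<Rightarrow> 'b \<Rightarrow> real^('s \<times> 's)" where
  "W_p W \<omega> = vec_of (transpose (W \<omega>))"

definition Lambda_block :: "real^'s^'s \<Rightarrow> 's \<Rightarrow> real^'s^'s" where
  "Lambda_block P i = (\<chi> j k. P $ i $ j * ((if j = k then 1 else 0) - P $ i $ k))"

definition Sigma_p :: "real^'s^'s \<Rightarrow> real^'s \<Rightarrow> real^('s \<times> 's)^('s \<times> 's)" where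
  "Sigma_p P \<pi> = (\<chi> a b. if fst a = fst b
     then inverse (\<pi> $ fst a) * Lambda_block P (fst a) $ snd a $ snd b else 0)"

lemma covariance_matrix_W_p:
  assumes "limit_gaussian_matrix N P \<pi> W"
  shows "covariance_matrix N (W_p W) = Sigma_p P \<pi>"
  using assms
  by (simp add: limit_gaussian_matrix_def covariance_matrix_def Sigma_p_def W_p_def vec_of_def
      Lambda_block_def transpose_def vec_eq_iff mult.assoc)

end

theory Submission
  imports Defs "HOL-Real_Asymp.Real_Asymp"
begin

text \<open>
  The identities for \<open>vec {\<Phi>'(W)\<^sup>T}\<close>, its covariance and the Kronecker form of \<open>L\<close> are linear algebra:
  covariance is bilinear (\<open>covariance_matrix_linear_image\<close>), and \<open>B \<otimes> A\<^sup>T\<close> represents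
  \<open>H \<mapsto> B H A\<close> in row stacking (\<open>vec_of_sandwich\<close>).

  The limit law is a central limit theorem for the chain followed by the delta method. The excess
  \<open>N_ij - N_i p_ij\<close> is a sum along the trajectory of a function of consecutive states whose average
  over the next state vanishes. Second moments of such centred path sums grow linearly
  (\<open>second_moment_path_sum\<close>). The other tool is the Poisson equation \<open>w - P w = v - (\<pi> \<bullet> v) 1\<close>, which
  is solvable for every \<open>v\<close> because the chain is irreducible (\<open>poisson_equation\<close>). Applied to the
  indicator of a state, it writes \<open>N_i - n \<pi>_i\<close> as a centred path sum plus a bounded term, so
  \<open>N_i / n \<longrightarrow> \<pi>_i\<close> in probability.

  The Poisson equation also gives the central limit theorem. Let \<open>w\<close> solve it for the conditional
  variance of the increments of a centred path sum \<open>S\<close>, with stationary mean \<open>\<sigma>2\<close>. Averaging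
  \<open>exp (i \<theta> S_m) (1 - \<theta>\<^sup>2 w(X_m) / 2)\<close> over one step multiplies it by the constant \<open>1 - \<theta>\<^sup>2 \<sigma>2 / 2\<close>, up to
  an error \<open>O(\<bar>\<theta>\<bar>\<^sup>3)\<close>: the correction \<open>w\<close> absorbs the fluctuations of the conditional variance. With
  \<open>\<theta> = t / sqrt n\<close>, after \<open>n\<close> steps the characteristic function of \<open>S_n / sqrt n\<close> is
  \<open>(1 - t\<^sup>2 \<sigma>2 / (2 n)) ^ n + O(1 / sqrt n)\<close>, which tends to \<open>exp (- t\<^sup>2 \<sigma>2 / 2)\<close>
  (\<open>path_sum_char_tendsto\<close>).

  Finally, \<open>sqrt n (P_hat - P)\<close> has entries \<open>(n / N_i) (N_ij - N_i p_ij) / sqrt n\<close>. These are bounded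
  in probability, so differentiability of \<open>\<Phi>\<close> replaces the plug-in error by its linear part, and
  \<open>n / N_i\<close> may be replaced by \<open>1 / \<pi>_i\<close> (\<open>delta_remainder_small\<close>). What remains is one centred path sum,
  whose limit variance is that of \<open>a \<Phi>'(W) c\<close> (\<open>influence_variance\<close>), and the Levy continuity theorem
  concludes.
\<close>

section \<open>Irreducible stochastic matrices\<close>

lemma stochastic_matrix_power:
  assumes "stochastic_matrix P"
  shows "stochastic_matrix (matrix_power P n)"
proof (induction n)
  case 0
  show ?case
    by (auto simp: stochastic_matrix_def mat_def)
next
  case (Suc n)
  have "(\<Sum>j\<in>UNIV. \<Sum>k\<in>UNIV. matrix_power P n $ i $ k * P $ k $ j) = 1" for i
    using assms Suc
    by (subst sum.swap) (simp add: stochastic_matrix_def flip: sum_distrib_left)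
  moreover have "0 \<le> matrix_power P (Suc n) $ i $ j" for i j
    using assms Suc
    by (auto simp: stochastic_matrix_def matrix_matrix_mult_def intro!: sum_nonneg)
  ultimately show ?case
    by (auto simp: stochastic_matrix_def matrix_matrix_mult_def)
qed

lemma stationary_vector_matrix_power:
  assumes "stationary_vector P \<pi>"
  shows "\<pi> v* matrix_power P n = \<pi>"
proof (induction n)
  case (Suc n)
  then show ?case
    using assms by (simp add: stationary_vector_def flip: vector_matrix_mul_assoc)
qed simp

lemma stationary_vector_pos:
  assumes "stochastic_matrix P" "irreducible_matrix P" "stationary_vector P \<pi>"
  shows "0 < \<pi> $ i"
proof -
  have nonneg: "0 \<le> \<pi> $ k" for k
    using assms(3) by (auto simp: stationary_vector_def)
  have "(\<Sum>k\<in>UNIV. \<pi> $ k) = 1"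
    using assms(3) by (auto simp: stationary_vector_def)
  then obtain k where k: "0 < \<pi> $ k"
    using nonneg by (metis sum_nonpos not_le zero_less_one)
  obtain n where n: "0 < matrix_power P n $ k $ i"
    using assms(2) by (auto simp: irreducible_matrix_def)
  have "0 < \<pi> $ k * matrix_power P n $ k $ i"
    using k n by simp
  also have "\<dots> \<le> (\<Sum>l\<in>UNIV. \<pi> $ l * matrix_power P n $ l $ i)"
    using stochastic_matrix_power[OF assms(1), of n] nonneg
    by (intro member_le_sum) (auto simp: stochastic_matrix_def)
  also have "\<dots> = (\<pi> v* matrix_power P n) $ i"
    by (simp add: vector_matrix_mult_def mult.commute)
  finally show ?thesis
    by (simp add: stationary_vector_matrix_power[OF assms(3)])
qed

text \<open>By the maximum principle: at a state where \<open>w\<close> is largest, the average of \<open>w\<close> under each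
  power of \<open>P\<close> equals the maximum, so \<open>w\<close> is maximal at every state that the power reaches.\<close>

lemma harmonic_imp_constant:
  fixes P :: "real^'s::finite^'s" and w :: "real^'s"
  assumes "stochastic_matrix P" "irreducible_matrix P" "P *v w = w"
  obtains c where "\<And>i. w $ i = c"
proof -
  have power: "matrix_power P n *v w = w" for n
    by (induction n) (simp_all add: assms(3) flip: matrix_vector_mul_assoc)
  obtain i where i: "\<And>j. w $ j \<le> w $ i"
  proof -
    have "Max (range (($) w)) \<in> range (($) w)"
      by (rule Max_in) auto
    then obtain i where "Max (range (($) w)) = w $ i"
      by blast
    then show thesis
      by (intro that[of i]) (metis Max_ge finite finite_imageI rangeI)
  qed
  have "w $ j = w $ i" for j
  proof -
    obtain n where n: "0 < matrix_power P n $ i $ j"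
      using assms(2) by (auto simp: irreducible_matrix_def)
    let ?Q = "matrix_power P n"
    have Q: "0 \<le> ?Q $ i $ k" "(\<Sum>k\<in>UNIV. ?Q $ i $ k) = 1" for k
      using stochastic_matrix_power[OF assms(1), of n] by (auto simp: stochastic_matrix_def)
    have "(\<Sum>k\<in>UNIV. ?Q $ i $ k * w $ k) = w $ i"
      using arg_cong[OF power[of n], of "\<lambda>v. v $ i"] by (simp add: matrix_vector_mult_def)
    then have "(\<Sum>k\<in>UNIV. ?Q $ i $ k * (w $ i - w $ k)) = 0"
      using Q(2) by (simp add: right_diff_distrib sum_subtractf flip: sum_distrib_right)
    then have "?Q $ i $ j * (w $ i - w $ j) = 0"
      using Q(1) i by (subst (asm) sum_nonneg_eq_0_iff) auto
    with n show ?thesis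
      by simp
  qed
  then show thesis
    by (rule that)
qed

text \<open>Adding the rank-one term \<open>(\<pi> \<bullet> w) 1\<close> to \<open>w - P w\<close> makes the map
  injective: pairing a kernel element with \<open>\<pi>\<close> shows first that \<open>\<pi> \<bullet> w = 0\<close>, then that \<open>w\<close> is
  harmonic, hence constant, hence zero. An injective linear map in finite dimension is onto, and
  pairing the resulting equation with \<open>\<pi>\<close> identifies the constant.\<close>

lemma poisson_equation:
  fixes P :: "real^'s::finite^'s" and \<pi> v :: "real^'s"
  assumes "stochastic_matrix P" "irreducible_matrix P" "stationary_vector P \<pi>"
  obtains w :: "real^'s"
  where "\<And>i. w $ i - (P *v w) $ i = v $ i - \<pi> \<bullet> v"
proof -
  \<comment> \<open>The rank-one term removes the constants from the kernel of \<open>w \<mapsto> w - P w\<close>.\<close>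
  define T :: "real^'s \<Rightarrow> real^'s" where "T w = w - P *v w + (\<pi> \<bullet> w) *\<^sub>R (\<chi> i. 1)" for w
  have pair: "\<pi> \<bullet> T w = \<pi> \<bullet> w" for w
  proof -
    have "\<pi> \<bullet> (P *v w) = (\<pi> v* P) \<bullet> w"
      by (metis dot_lmul_matrix)
    moreover have "\<pi> v* P = \<pi>" "\<pi> \<bullet> (\<chi> i. 1) = 1"
      using assms(3) by (auto simp: stationary_vector_def inner_vec_def)
    ultimately show ?thesis
      by (simp add: T_def inner_diff_right inner_add_right)
  qed
  have lin: "linear T"
    unfolding T_def
    by (intro linearI)
      (simp_all add: matrix_vector_right_distrib matrix_vector_mult_scaleR inner_add_right
        scaleR_add_left scaleR_diff_right scaleR_add_right)
  have "inj T"
    unfolding linear_injective_0[OF lin]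
  proof safe
    fix w assume w: "T w = 0"
    then have 0: "\<pi> \<bullet> w = 0"
      using pair[of w] by simp
    then have "P *v w = w"
      using w by (simp add: T_def)
    then obtain c where c: "\<And>i. w $ i = c"
      using harmonic_imp_constant assms(1,2) by blast
    have "\<pi> \<bullet> w = c"
      using assms(3) by (simp add: c stationary_vector_def inner_vec_def flip: sum_distrib_right)
    with 0 c show "w = 0"
      by (simp add: vec_eq_iff)
  qed
  then have "surj T"
    by (rule linear_injective_imp_surjective[OF lin]) simp
  then obtain w where w: "T w = v"
    by (metis surjD)
  have "w $ i - (P *v w) $ i = v $ i - \<pi> \<bullet> v" for i
    using pair[of w] by (simp add: T_def flip: w)
  then show thesis
    by (rule that)
qed

section \<open>One-step averaging along the trajectory\<close>

locale markov_trajectory = prob_space M for M :: "'a measure" +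
  fixes P :: "real^'s::finite^'s" and X :: "nat \<Rightarrow> 'a \<Rightarrow> 's"
  assumes stochastic: "stochastic_matrix P" and chain: "markov_chain M P X"
begin

lemma P_nonneg: "0 \<le> P $ i $ j"
  and P_row_sum: "(\<Sum>j\<in>UNIV. P $ i $ j) = 1"
  using stochastic by (auto simp: stochastic_matrix_def)

lemma X_measurable [measurable]: "X n \<in> measurable M (count_space UNIV)"
  using chain by (auto simp: markov_chain_def)

text \<open>Restricting to the times up to \<open>n\<close> leaves only finitely many possible histories, so every
  function of the history is integrable and every expectation is a finite sum.\<close>

definition history :: "nat \<Rightarrow> 'a \<Rightarrow> nat \<Rightarrow> 's" where
  "history n \<omega> = restrict (\<lambda>k. X k \<omega>) {..n}"

lemma history_in: "history n \<omega> \<in> PiE {..n} (\<lambda>_. UNIV)"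
  by (auto simp: history_def)

lemma history_eq_iff:
  assumes "x \<in> PiE {..n} (\<lambda>_. UNIV)"
  shows "history n \<omega> = x \<longleftrightarrow> (\<forall>k\<le>n. X k \<omega> = x k)"
  using assms by (auto simp: history_def fun_eq_iff PiE_def extensional_def restrict_def)

lemma finite_histories: "finite (PiE {..n::nat} (\<lambda>_. UNIV :: 's set))"
  by (intro finite_PiE) auto

lemma prob_history_step:
  "\<P>(\<omega> in M. (\<forall>k\<le>n. X k \<omega> = x k) \<and> X (Suc n) \<omega> = j) =
   \<P>(\<omega> in M. \<forall>k\<le>n. X k \<omega> = x k) * P $ x n $ j"
proof (cases "\<P>(\<omega> in M. \<forall>k\<le>n. X k \<omega> = x k) > 0")
  case True
  then have "\<P>(\<omega> in M. X (Suc n) \<omega> = j \<bar> \<forall>k\<le>n. X k \<omega> = x k) = P $ x n $ j"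
    using chain by (auto simp: markov_chain_def)
  with True show ?thesis
    by (simp add: cond_prob_def field_simps conj_commute)
next
  case False
  then have 0: "\<P>(\<omega> in M. \<forall>k\<le>n. X k \<omega> = x k) = 0"
    by (simp add: zero_less_measure_iff)
  have "\<P>(\<omega> in M. (\<forall>k\<le>n. X k \<omega> = x k) \<and> X (Suc n) \<omega> = j) \<le> \<P>(\<omega> in M. \<forall>k\<le>n. X k \<omega> = x k)"
    by (intro finite_measure_mono) auto
  with 0 show ?thesis
    using measure_nonneg[of M "{\<omega> \<in> space M. (\<forall>k\<le>n. X k \<omega> = x k) \<and> X (Suc n) \<omega> = j}"] by simp
qed

lemma history_measurable [measurable]: "history n \<in> measurable M (count_space UNIV)"
proof -
  have "history n -` {x} \<inter> space M \<in> sets M" if "x \<in> PiE {..n} (\<lambda>_. UNIV)" for x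
  proof -
    have "history n -` {x} \<inter> space M = {\<omega> \<in> space M. \<forall>k\<le>n. X k \<omega> = x k}"
      using history_eq_iff[OF that] by auto
    then show ?thesis
      by simp
  qed
  then have "history n \<in> measurable M (count_space (PiE {..n} (\<lambda>_. UNIV)))"
    using finite_histories history_in
    by (subst measurable_count_space_eq2) auto
  then show ?thesis
    by (rule measurable_compose) auto
qed

text \<open>The Markov property in integrated form. Only finitely many histories occur, so both sides
  are finite sums over histories and next states, and the defining property of the chain
  identifies them term by term.\<close>

lemma one_step_averaging:
  fixes g :: "(nat \<Rightarrow> 's) \<Rightarrow> 's \<Rightarrow> 'c::{banach, second_countable_topology}"
  shows "(\<integral>\<omega>. g (history n \<omega>) (X (Suc n) \<omega>) \<partial>M) =
    (\<integral>\<omega>. (\<Sum>j\<in>UNIV. (P $ X n \<omega> $ j) *\<^sub>R g (history n \<omega>) j) \<partial>M)"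
proof -
  let ?H = "PiE {..n} (\<lambda>_. UNIV :: 's set)"
  let ?A = "\<lambda>x. {\<omega> \<in> space M. \<forall>k\<le>n. X k \<omega> = x k}"
  let ?B = "\<lambda>x j. {\<omega> \<in> space M. (\<forall>k\<le>n. X k \<omega> = x k) \<and> X (Suc n) \<omega> = j}"
  have integral_blocks: "(\<integral>\<omega>. (\<Sum>x\<in>?H. \<Sum>j\<in>UNIV. indicat_real (C x j) \<omega> *\<^sub>R f x j) \<partial>M) =
      (\<Sum>x\<in>?H. \<Sum>j\<in>UNIV. prob (C x j) *\<^sub>R f x j)"
    if "\<And>x j. C x j \<in> sets M" for C :: "(nat \<Rightarrow> 's) \<Rightarrow> 's \<Rightarrow> 'a set" and f :: "(nat \<Rightarrow> 's) \<Rightarrow> 's \<Rightarrow> 'c"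
  proof -
    have "has_bochner_integral M (\<lambda>\<omega>. \<Sum>x\<in>?H. \<Sum>j\<in>UNIV. indicat_real (C x j) \<omega> *\<^sub>R f x j)
        (\<Sum>x\<in>?H. \<Sum>j\<in>UNIV. prob (C x j) *\<^sub>R f x j)"
      using that
      by (intro has_bochner_integral_sum has_bochner_integral_scaleR_left
          has_bochner_integral_real_indicator) (auto simp: less_top[symmetric])
    then show ?thesis
      by (rule has_bochner_integral_integral_eq)
  qed
  have 1: "g (history n \<omega>) (X (Suc n) \<omega>) = (\<Sum>x\<in>?H. \<Sum>j\<in>UNIV. indicat_real (?B x j) \<omega> *\<^sub>R g x j)"
    if "\<omega> \<in> space M" for \<omega>
  proof -
    have "indicat_real (?B x j) \<omega> *\<^sub>R g x j =
        (if j = X (Suc n) \<omega> then if x = history n \<omega> then g x j else 0 else 0)" if "x \<in> ?H" for x j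
      using history_eq_iff[OF that, of \<omega>] \<open>\<omega> \<in> space M\<close> by (auto simp: indicator_def)
    then show ?thesis
      by (simp add: finite_histories history_in cong: sum.cong)
  qed
  have 2: "(\<Sum>j\<in>UNIV. (P $ X n \<omega> $ j) *\<^sub>R g (history n \<omega>) j) =
      (\<Sum>x\<in>?H. \<Sum>j\<in>UNIV. indicat_real (?A x) \<omega> *\<^sub>R (P $ x n $ j) *\<^sub>R g x j)"
    if "\<omega> \<in> space M" for \<omega>
  proof -
    have "(\<Sum>j\<in>UNIV. indicat_real (?A x) \<omega> *\<^sub>R (P $ x n $ j) *\<^sub>R g x j) =
        (if x = history n \<omega> then \<Sum>j\<in>UNIV. (P $ x n $ j) *\<^sub>R g x j else 0)" if "x \<in> ?H" for x
      using history_eq_iff[OF that, of \<omega>] \<open>\<omega> \<in> space M\<close> by (auto simp: indicator_def)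
    moreover have "history n \<omega> n = X n \<omega>"
      by (simp add: history_def)
    ultimately show ?thesis
      by (simp add: finite_histories history_in cong: sum.cong)
  qed
  have "(\<integral>\<omega>. g (history n \<omega>) (X (Suc n) \<omega>) \<partial>M) =
      (\<integral>\<omega>. (\<Sum>x\<in>?H. \<Sum>j\<in>UNIV. indicat_real (?B x j) \<omega> *\<^sub>R g x j) \<partial>M)"
    by (intro Bochner_Integration.integral_cong refl 1)
  also have "\<dots> = (\<Sum>x\<in>?H. \<Sum>j\<in>UNIV. prob (?B x j) *\<^sub>R g x j)"
    by (rule integral_blocks) simp
  also have "\<dots> = (\<Sum>x\<in>?H. \<Sum>j\<in>UNIV. prob (?A x) *\<^sub>R (P $ x n $ j) *\<^sub>R g x j)"
    by (simp add: prob_history_step)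
  also have "\<dots> = (\<integral>\<omega>. (\<Sum>x\<in>?H. \<Sum>j\<in>UNIV. indicat_real (?A x) \<omega> *\<^sub>R (P $ x n $ j) *\<^sub>R g x j) \<partial>M)"
    by (rule integral_blocks[symmetric]) simp
  also have "\<dots> = (\<integral>\<omega>. (\<Sum>j\<in>UNIV. (P $ X n \<omega> $ j) *\<^sub>R g (history n \<omega>) j) \<partial>M)"
    by (intro Bochner_Integration.integral_cong refl 2[symmetric])
  finally show ?thesis .
qed


lemma integrable_history:
  fixes F :: "(nat \<Rightarrow> 's) \<Rightarrow> 'c::{banach, second_countable_topology}"
  shows "integrable M (\<lambda>\<omega>. F (history n \<omega>))"
proof (rule integrable_const_bound)
  let ?H = "PiE {..n} (\<lambda>_. UNIV :: 's set)"
  show "AE \<omega> in M. norm (F (history n \<omega>)) \<le> Max ((\<lambda>h. norm (F h)) ` ?H)"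
    using finite_histories[of n] history_in by (intro AE_I2 Max_ge) auto
  show "(\<lambda>\<omega>. F (history n \<omega>)) \<in> borel_measurable M"
    by (rule measurable_compose[OF history_measurable]) simp
qed

definition path_sum :: "('s \<Rightarrow> 's \<Rightarrow> real) \<Rightarrow> nat \<Rightarrow> 'a \<Rightarrow> real" where
  "path_sum d n \<omega> = (\<Sum>m<n. d (X m \<omega>) (X (Suc m) \<omega>))"

lemma path_sum_0 [simp]: "path_sum d 0 \<omega> = 0"
  and path_sum_Suc: "path_sum d (Suc n) \<omega> = path_sum d n \<omega> + d (X n \<omega>) (X (Suc n) \<omega>)"
  by (simp_all add: path_sum_def)

lemma integrable_path_sum:
  fixes F :: "real \<Rightarrow> 's \<Rightarrow> 'c::{banach, second_countable_topology}"
  shows "integrable M (\<lambda>\<omega>. F (path_sum d n \<omega>) (X n \<omega>))"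
proof -
  have "integrable M (\<lambda>\<omega>. (\<lambda>h. F (\<Sum>m<n. d (h m) (h (Suc m))) (h n)) (history n \<omega>))"
    by (rule integrable_history)
  then show ?thesis
    by (simp add: path_sum_def history_def)
qed

lemma path_sum_measurable [measurable]: "path_sum d n \<in> borel_measurable M"
  using integrable_path_sum[of "\<lambda>x _. x" d n] by (rule borel_measurable_integrable)

lemma path_sum_step:
  fixes F :: "real \<Rightarrow> 's \<Rightarrow> 'c::{banach, second_countable_topology}"
  shows "(\<integral>\<omega>. F (path_sum d (Suc n) \<omega>) (X (Suc n) \<omega>) \<partial>M) =
    (\<integral>\<omega>. (\<Sum>j\<in>UNIV. (P $ X n \<omega> $ j) *\<^sub>R F (path_sum d n \<omega> + d (X n \<omega>) j) j) \<partial>M)"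
proof -
  have "(\<integral>\<omega>. (\<lambda>h j. F ((\<Sum>m<n. d (h m) (h (Suc m))) + d (h n) j) j) (history n \<omega>) (X (Suc n) \<omega>) \<partial>M) =
    (\<integral>\<omega>. (\<Sum>j\<in>UNIV. (P $ X n \<omega> $ j) *\<^sub>R
      (\<lambda>h j. F ((\<Sum>m<n. d (h m) (h (Suc m))) + d (h n) j) j) (history n \<omega>) j) \<partial>M)"
    by (rule one_step_averaging)
  then show ?thesis
    by (simp add: path_sum_Suc) (simp add: path_sum_def history_def)
qed

text \<open>The increments of a centred path sum are martingale differences for the trajectory.\<close>

definition centred :: "('s \<Rightarrow> 's \<Rightarrow> real) \<Rightarrow> bool" where
  "centred d \<longleftrightarrow> (\<forall>i. (\<Sum>j\<in>UNIV. P $ i $ j * d i j) = 0)"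

text \<open>The increments of a centred path sum are orthogonal, so its second moment grows linearly.\<close>

lemma second_moment_path_sum:
  assumes "centred d" and K: "\<And>i j. \<bar>d i j\<bar> \<le> K"
  shows "(\<integral>\<omega>. (path_sum d n \<omega>)\<^sup>2 \<partial>M) \<le> real n * K\<^sup>2"
proof (induction n)
  case (Suc n)
  have le: "(\<Sum>j\<in>UNIV. P $ i $ j * (s + d i j)\<^sup>2) \<le> s\<^sup>2 + K\<^sup>2" for s i
  proof -
    have "(\<Sum>j\<in>UNIV. P $ i $ j * (s + d i j)\<^sup>2) =
        (\<Sum>j\<in>UNIV. s\<^sup>2 * P $ i $ j + 2 * s * (P $ i $ j * d i j) + P $ i $ j * (d i j)\<^sup>2)"
      by (intro sum.cong refl) (simp add: power2_eq_square algebra_simps)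
    also have "\<dots> = s\<^sup>2 + (\<Sum>j\<in>UNIV. P $ i $ j * (d i j)\<^sup>2)"
      using assms(1) by (simp add: sum.distrib centred_def P_row_sum flip: sum_distrib_left)
    also have "(\<Sum>j\<in>UNIV. P $ i $ j * (d i j)\<^sup>2) \<le> (\<Sum>j\<in>UNIV. P $ i $ j * K\<^sup>2)"
      using power_mono[OF K abs_ge_zero, of _ _ 2] by (intro sum_mono mult_left_mono P_nonneg) simp
    also have "\<dots> = K\<^sup>2"
      by (simp add: P_row_sum flip: sum_distrib_right)
    finally show ?thesis
      by simp
  qed
  have "(\<integral>\<omega>. (path_sum d (Suc n) \<omega>)\<^sup>2 \<partial>M) =
      (\<integral>\<omega>. (\<Sum>j\<in>UNIV. P $ X n \<omega> $ j * (path_sum d n \<omega> + d (X n \<omega>) j)\<^sup>2) \<partial>M)"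
    using path_sum_step[of "\<lambda>s _. s\<^sup>2" d n] by simp
  also have "\<dots> \<le> (\<integral>\<omega>. (path_sum d n \<omega>)\<^sup>2 + K\<^sup>2 \<partial>M)"
    by (intro integral_mono le integrable_path_sum[of "\<lambda>s i. \<Sum>j\<in>UNIV. P $ i $ j * (s + d i j)\<^sup>2"]
        integrable_path_sum[of "\<lambda>s _. s\<^sup>2 + K\<^sup>2"])
  also have "\<dots> = (\<integral>\<omega>. (path_sum d n \<omega>)\<^sup>2 \<partial>M) + K\<^sup>2"
    using integrable_path_sum[of "\<lambda>s _. s\<^sup>2" d n] by (simp add: prob_space)
  finally show ?case
    using Suc by (simp add: algebra_simps)
qed simp

lemma centred_path_sum_tail:
  assumes "centred d" and K: "\<And>i j. \<bar>d i j\<bar> \<le> K" and "0 < c"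
  shows "prob {\<omega> \<in> space M. c \<le> \<bar>path_sum d n \<omega>\<bar>} \<le> real n * K\<^sup>2 / c\<^sup>2"
proof -
  have "prob {\<omega> \<in> space M. c \<le> \<bar>path_sum d n \<omega>\<bar>} = prob {\<omega> \<in> space M. c\<^sup>2 \<le> (path_sum d n \<omega>)\<^sup>2}"
    using \<open>0 < c\<close> by (simp add: abs_le_square_iff[symmetric])
  also have "\<dots> \<le> (\<integral>\<omega>. (path_sum d n \<omega>)\<^sup>2 \<partial>M) / c\<^sup>2"
    using \<open>0 < c\<close> integrable_path_sum[of "\<lambda>s _. s\<^sup>2" d n]
    by (intro integral_Markov_inequality_measure[where A="space M"]) auto
  also have "\<dots> \<le> real n * K\<^sup>2 / c\<^sup>2"
    using second_moment_path_sum[OF assms(1) K] by (intro divide_right_mono) auto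
  finally show ?thesis .
qed

section \<open>The central limit theorem for centred path sums\<close>

text \<open>The one-step estimate behind the central limit theorem. To second order, the average of
  \<open>exp (i \<theta> d) (1 - \<theta>\<^sup>2 w / 2)\<close> over the next state is \<open>1 - \<theta>\<^sup>2 (v + P w) / 2\<close>, where \<open>v\<close> is the
  conditional variance. The Poisson equation \<open>v + P w = \<sigma>2 + w\<close> turns this into the product of
  \<open>1 - \<theta>\<^sup>2 \<sigma>2 / 2\<close> and the correction at the current state.\<close>

lemma corrected_char_step_error:
  fixes w :: "real^'s"
  assumes "centred d" and K: "\<And>i j. \<bar>d i j\<bar> \<le> K" and W: "\<And>i. \<bar>w $ i\<bar> \<le> W"
    and poisson: "\<And>i. w $ i - (P *v w) $ i = (\<Sum>j\<in>UNIV. P $ i $ j * (d i j)\<^sup>2) - \<sigma>2"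
    and "\<bar>\<theta>\<bar> \<le> 1"
  shows "cmod ((\<Sum>j\<in>UNIV. (P $ i $ j) *\<^sub>R (iexp (\<theta> * d i j) * (1 - \<theta>\<^sup>2 / 2 * w $ j))) -
      (1 - \<theta>\<^sup>2 * \<sigma>2 / 2) * (1 - \<theta>\<^sup>2 / 2 * w $ i)) \<le> (K ^ 3 + W * K + \<bar>\<sigma>2\<bar> * W) * \<bar>\<theta>\<bar> ^ 3"
proof -
  \<comment> \<open>Taylor remainders of order two and of order zero; the second is multiplied by
    \<open>\<theta>\<^sup>2\<close>, so both contribute \<open>O(\<bar>\<theta>\<bar>\<^sup>3)\<close>.\<close>
  define e where "e j = iexp (\<theta> * d i j) - (1 + \<i> * (\<theta> * d i j) - (\<theta> * d i j)\<^sup>2 / 2)" for j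
  define f where "f j = iexp (\<theta> * d i j) - 1" for j
  have K0: "0 \<le> K"
    using K[of i i] by (rule order_trans[OF abs_ge_zero])
  have W0: "0 \<le> W"
    using W[of i] by (rule order_trans[OF abs_ge_zero])
  have td: "\<bar>\<theta> * d i j\<bar> \<le> \<bar>\<theta>\<bar> * K" for j
    using K[of i j] by (simp add: abs_mult mult_left_mono)
  have e: "cmod (e j) \<le> \<bar>\<theta>\<bar> ^ 3 * K ^ 3" for j
  proof -
    have "cmod (e j) \<le> \<bar>\<theta> * d i j\<bar> ^ 3 / 6"
      using iexp_approx1[of "\<theta> * d i j" 2]
      by (simp add: e_def eval_nat_numeral algebra_simps fact_numeral)
    also have "\<dots> \<le> \<bar>\<theta> * d i j\<bar> ^ 3"
      by simp
    also have "\<dots> \<le> (\<bar>\<theta>\<bar> * K) ^ 3"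
      by (intro power_mono td) auto
    finally show ?thesis
      by (simp add: power_mult_distrib)
  qed
  have f: "cmod (f j) \<le> \<bar>\<theta>\<bar> * K" for j
    using iexp_approx1[of "\<theta> * d i j" 0] td[of j] by (simp add: f_def)
  have r: "cmod (e j - \<theta>\<^sup>2 / 2 * w $ j * f j) \<le> (K ^ 3 + W * K) * \<bar>\<theta>\<bar> ^ 3" for j
  proof -
    have "cmod (\<theta>\<^sup>2 / 2 * w $ j * f j) = \<theta>\<^sup>2 / 2 * \<bar>w $ j\<bar> * cmod (f j)"
      by (simp add: norm_mult norm_divide norm_power)
    also have "\<dots> \<le> \<theta>\<^sup>2 * W * (\<bar>\<theta>\<bar> * K)"
      using W[of j] f[of j] W0 by (intro mult_mono) auto
    also have "\<dots> = W * K * \<bar>\<theta>\<bar> ^ 3"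
      by (simp add: power3_eq_cube power2_eq_square)
    finally show ?thesis
      using e[of j] norm_triangle_ineq4[of "e j" "\<theta>\<^sup>2 / 2 * w $ j * f j"]
      by (simp add: algebra_simps)
  qed
  define R where "R = (\<Sum>j\<in>UNIV. (P $ i $ j) *\<^sub>R (e j - \<theta>\<^sup>2 / 2 * w $ j * f j))"
  have expand: "iexp (\<theta> * d i j) * (1 - \<theta>\<^sup>2 / 2 * w $ j) =
      1 + (\<i> * \<theta>) * d i j - \<theta>\<^sup>2 / 2 * (d i j)\<^sup>2 - \<theta>\<^sup>2 / 2 * w $ j + (e j - \<theta>\<^sup>2 / 2 * w $ j * f j)" for j
    by (simp add: e_def f_def field_simps power_mult_distrib)
  have sums: "(\<Sum>j\<in>UNIV. complex_of_real (P $ i $ j)) = 1"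
    "(\<Sum>j\<in>UNIV. complex_of_real (P $ i $ j * d i j)) = 0"
    "(\<Sum>j\<in>UNIV. complex_of_real (P $ i $ j * (d i j)\<^sup>2 + P $ i $ j * w $ j)) = complex_of_real (\<sigma>2 + w $ i)"
    using assms(1) poisson[of i]
    by (simp_all add: P_row_sum centred_def sum.distrib matrix_vector_mult_def
        del: of_real_add of_real_mult flip: of_real_sum)
  have "(\<Sum>j\<in>UNIV. (P $ i $ j) *\<^sub>R (iexp (\<theta> * d i j) * (1 - \<theta>\<^sup>2 / 2 * w $ j))) =
      (\<Sum>j\<in>UNIV. complex_of_real (P $ i $ j) + (\<i> * \<theta>) * complex_of_real (P $ i $ j * d i j)
        - complex_of_real (\<theta>\<^sup>2 / 2) * complex_of_real (P $ i $ j * (d i j)\<^sup>2 + P $ i $ j * w $ j)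
        + (P $ i $ j) *\<^sub>R (e j - \<theta>\<^sup>2 / 2 * w $ j * f j))"
    unfolding expand by (intro sum.cong refl) (simp add: scaleR_conv_of_real algebra_simps)
  also have "\<dots> = 1 - complex_of_real (\<theta>\<^sup>2 / 2) * complex_of_real (\<sigma>2 + w $ i) + R"
    unfolding sum.distrib sum_subtractf sum_distrib_left[symmetric] R_def[symmetric] sums by simp
  finally have total: "(\<Sum>j\<in>UNIV. (P $ i $ j) *\<^sub>R (iexp (\<theta> * d i j) * (1 - \<theta>\<^sup>2 / 2 * w $ j))) =
      1 - complex_of_real (\<theta>\<^sup>2 / 2) * complex_of_real (\<sigma>2 + w $ i) + R" .
  have diff: "(\<Sum>j\<in>UNIV. (P $ i $ j) *\<^sub>R (iexp (\<theta> * d i j) * (1 - \<theta>\<^sup>2 / 2 * w $ j))) -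
      (1 - \<theta>\<^sup>2 * \<sigma>2 / 2) * (1 - \<theta>\<^sup>2 / 2 * w $ i) =
      R - of_real (\<theta> ^ 4 * \<sigma>2 * w $ i / 4)"
    unfolding total by (simp add: field_simps power2_eq_square power4_eq_xxxx)
  have "cmod R \<le> (\<Sum>j\<in>UNIV. P $ i $ j * ((K ^ 3 + W * K) * \<bar>\<theta>\<bar> ^ 3))"
    unfolding R_def using r by (intro sum_norm_le) (simp add: P_nonneg mult_left_mono)
  also have "\<dots> = (K ^ 3 + W * K) * \<bar>\<theta>\<bar> ^ 3"
    by (simp add: P_row_sum flip: sum_distrib_right)
  finally have R: "cmod R \<le> (K ^ 3 + W * K) * \<bar>\<theta>\<bar> ^ 3" .
  have "cmod (of_real (\<theta> ^ 4 * \<sigma>2 * w $ i / 4)) = \<bar>\<theta>\<bar> ^ 4 * (\<bar>\<sigma>2\<bar> * (\<bar>w $ i\<bar> / 4))"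
    unfolding norm_of_real by (simp add: abs_mult power_abs)
  also have "\<dots> \<le> \<bar>\<theta>\<bar> ^ 3 * (\<bar>\<sigma>2\<bar> * W)"
    using W[of i] W0 assms(5) power_decreasing[of 3 4 "\<bar>\<theta>\<bar>"]
    by (intro mult_mono) auto
  finally have quartic: "cmod (of_real (\<theta> ^ 4 * \<sigma>2 * w $ i / 4)) \<le> \<bar>\<sigma>2\<bar> * W * \<bar>\<theta>\<bar> ^ 3"
    by (simp only: ac_simps)
  show ?thesis
    unfolding diff using norm_triangle_le_diff[OF add_mono[OF R quartic]]
    by (simp only: distrib_right)
qed


text \<open>The one-step estimate is iterated. The factor \<open>1 - \<theta>\<^sup>2 \<sigma>2 / 2\<close> has modulus at most one, so the
  errors of the \<open>n\<close> steps only add up. Inserting the correction at time \<open>0\<close> and removing it at time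
  \<open>n\<close> costs \<open>W \<theta>\<^sup>2 / 2\<close> each.\<close>

lemma path_sum_char_approx:
  fixes d :: "'s \<Rightarrow> 's \<Rightarrow> real"
  assumes "centred d" and K: "\<And>i j. \<bar>d i j\<bar> \<le> K" and W: "\<And>i. \<bar>w $ i\<bar> \<le> W"
    and poisson: "\<And>i. w $ i - (P *v w) $ i = (\<Sum>j\<in>UNIV. P $ i $ j * (d i j)\<^sup>2) - \<sigma>2"
    and \<theta>: "\<bar>\<theta>\<bar> \<le> 1" "\<theta>\<^sup>2 * \<sigma>2 \<le> 2" and \<sigma>2: "0 \<le> \<sigma>2"
  shows "cmod ((\<integral>\<omega>. iexp (\<theta> * path_sum d n \<omega>) \<partial>M) - (1 - \<theta>\<^sup>2 * \<sigma>2 / 2) ^ n) \<le>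
    W * \<theta>\<^sup>2 + real n * ((K ^ 3 + W * K + \<sigma>2 * W) * \<bar>\<theta>\<bar> ^ 3)"
proof -
  define \<rho> where "\<rho> = 1 - \<theta>\<^sup>2 * \<sigma>2 / 2"
  define C where "C = (K ^ 3 + W * K + \<sigma>2 * W) * \<bar>\<theta>\<bar> ^ 3"
  define u where "u i = complex_of_real (1 - \<theta>\<^sup>2 / 2 * w $ i)" for i
  define a where "a m = (\<integral>\<omega>. iexp (\<theta> * path_sum d m \<omega>) * u (X m \<omega>) \<partial>M)" for m
  have \<rho>: "\<bar>\<rho>\<bar> \<le> 1"
    using \<theta>(2) \<sigma>2 by (auto simp: \<rho>_def abs_le_iff)
  have W0: "0 \<le> W"
    using W by (meson abs_ge_zero order_trans)
  have u: "cmod (u i - 1) \<le> W * \<theta>\<^sup>2 / 2" for i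
  proof -
    have "cmod (u i - 1) = \<bar>w $ i\<bar> * (\<theta>\<^sup>2 / 2)"
      by (simp add: u_def norm_mult norm_divide norm_power)
    also have "\<dots> \<le> W * (\<theta>\<^sup>2 / 2)"
      using W[of i] by (intro mult_right_mono) auto
    finally show ?thesis
      by simp
  qed
  have step: "cmod (a (Suc m) - \<rho> * a m) \<le> C" for m
  proof -
    define r where "r i = (\<Sum>j\<in>UNIV. (P $ i $ j) *\<^sub>R (iexp (\<theta> * d i j) * u j)) - \<rho> * u i" for i
    have r: "cmod (r i) \<le> C" for i
      using corrected_char_step_error[OF assms(1) K W poisson \<theta>(1), of i] \<sigma>2
      by (simp add: r_def u_def \<rho>_def C_def)
    have average: "(\<Sum>j\<in>UNIV. (P $ i $ j) *\<^sub>R (iexp (\<theta> * (s + d i j)) * u j)) =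
        \<rho> * (iexp (\<theta> * s) * u i) + iexp (\<theta> * s) * r i" for s i
    proof -
      have "iexp (\<theta> * (s + d i j)) = iexp (\<theta> * s) * iexp (\<theta> * d i j)" for j
        by (simp add: distrib_left flip: exp_add)
      then show ?thesis
        by (simp add: r_def sum_distrib_left algebra_simps)
    qed
    have "a (Suc m) = (\<integral>\<omega>. (\<Sum>j\<in>UNIV. (P $ X m \<omega> $ j) *\<^sub>R
        (iexp (\<theta> * (path_sum d m \<omega> + d (X m \<omega>) j)) * u j)) \<partial>M)"
      unfolding a_def by (rule path_sum_step[of "\<lambda>s i. iexp (\<theta> * s) * u i"])
    also have "\<dots> = (\<integral>\<omega>. \<rho> * (iexp (\<theta> * path_sum d m \<omega>) * u (X m \<omega>)) +
        iexp (\<theta> * path_sum d m \<omega>) * r (X m \<omega>) \<partial>M)"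
      unfolding average ..
    also have "\<dots> = \<rho> * a m + (\<integral>\<omega>. iexp (\<theta> * path_sum d m \<omega>) * r (X m \<omega>) \<partial>M)"
      unfolding a_def
      using integrable_path_sum[of "\<lambda>s i. iexp (\<theta> * s) * u i" d m]
        integrable_path_sum[of "\<lambda>s i. iexp (\<theta> * s) * r i" d m] by simp
    finally have "a (Suc m) - \<rho> * a m = (\<integral>\<omega>. iexp (\<theta> * path_sum d m \<omega>) * r (X m \<omega>) \<partial>M)"
      by simp
    also have "cmod \<dots> \<le> (\<integral>\<omega>. cmod (iexp (\<theta> * path_sum d m \<omega>) * r (X m \<omega>)) \<partial>M)"
      by (rule integral_norm_bound)
    also have "\<dots> \<le> (\<integral>\<omega>. C \<partial>M)"
      using integrable_path_sum[of "\<lambda>s i. cmod (iexp (\<theta> * s) * r i)" d m] r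
      by (intro integral_mono) (auto simp: norm_mult)
    finally show ?thesis
      by (simp add: prob_space)
  qed
  have iter: "cmod (a m - \<rho> ^ m * a 0) \<le> real m * C" for m
  proof (induction m)
    case (Suc m)
    have "a (Suc m) - \<rho> ^ Suc m * a 0 = (a (Suc m) - \<rho> * a m) + \<rho> * (a m - \<rho> ^ m * a 0)"
      by (simp add: algebra_simps)
    also have "cmod \<dots> \<le> C + \<bar>\<rho>\<bar> * (real m * C)"
      using Suc step[of m] by (intro norm_triangle_mono) (auto simp: norm_mult intro!: mult_left_mono)
    also have "\<dots> \<le> C + 1 * (real m * C)"
      using \<rho> order_trans[OF norm_ge_zero step] by (intro add_left_mono mult_right_mono) auto
    finally show ?case
      by (simp add: algebra_simps)
  qed simp
  have correction: "cmod (a m - (\<integral>\<omega>. iexp (\<theta> * path_sum d m \<omega>) \<partial>M)) \<le> W * \<theta>\<^sup>2 / 2" for m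
  proof -
    have "a m - (\<integral>\<omega>. iexp (\<theta> * path_sum d m \<omega>) \<partial>M) =
        (\<integral>\<omega>. iexp (\<theta> * path_sum d m \<omega>) * u (X m \<omega>) - iexp (\<theta> * path_sum d m \<omega>) \<partial>M)"
      unfolding a_def
      using integrable_path_sum[of "\<lambda>s i. iexp (\<theta> * s) * u i" d m]
        integrable_path_sum[of "\<lambda>s i. iexp (\<theta> * s)" d m] by simp
    also have "cmod \<dots> \<le> (\<integral>\<omega>. cmod (iexp (\<theta> * path_sum d m \<omega>) * u (X m \<omega>) - iexp (\<theta> * path_sum d m \<omega>)) \<partial>M)"
      by (rule integral_norm_bound)
    also have "\<dots> \<le> (\<integral>\<omega>. W * \<theta>\<^sup>2 / 2 \<partial>M)"
    proof (intro integral_mono)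
      show "integrable M (\<lambda>\<omega>. cmod (iexp (\<theta> * path_sum d m \<omega>) * u (X m \<omega>) - iexp (\<theta> * path_sum d m \<omega>)))"
        by (rule integrable_path_sum[of "\<lambda>s i. cmod (iexp (\<theta> * s) * u i - iexp (\<theta> * s))"])
      have "iexp s * u i - iexp s = iexp s * (u i - 1)" for s i
        by (simp add: algebra_simps)
      then have "cmod (iexp s * u i - iexp s) = cmod (u i - 1)" for s i
        by (simp only: norm_mult norm_exp_i_times mult_1)
      then show "cmod (iexp (\<theta> * path_sum d m \<omega>) * u (X m \<omega>) - iexp (\<theta> * path_sum d m \<omega>)) \<le> W * \<theta>\<^sup>2 / 2" for \<omega>
        using u by (simp only:)
    qed simp
    finally show ?thesis
      by (simp add: prob_space)
  qed
  let ?b = "\<integral>\<omega>. iexp (\<theta> * path_sum d n \<omega>) \<partial>M"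
  have "?b - \<rho> ^ n = (a n - \<rho> ^ n * a 0) - (a n - ?b) + \<rho> ^ n * (a 0 - 1)"
    by (simp add: algebra_simps)
  moreover have "cmod (\<rho> ^ n * (a 0 - 1)) \<le> 1 * (W * \<theta>\<^sup>2 / 2)"
    unfolding norm_mult
    using correction[of 0] \<rho> power_mono[OF \<rho>, of n]
    by (intro mult_mono) (auto simp: norm_power prob_space)
  ultimately have "cmod (?b - \<rho> ^ n) \<le> real n * C + W * \<theta>\<^sup>2 / 2 + 1 * (W * \<theta>\<^sup>2 / 2)"
    using norm_triangle_le[OF add_mono[OF norm_triangle_le_diff[OF add_mono[OF iter correction]]]]
    by (simp only: )
  then show ?thesis
    by (simp add: \<rho>_def C_def)
qed

text \<open>With \<open>\<theta> = t / sqrt n\<close> the accumulated error is of order \<open>n \<bar>\<theta>\<bar>\<^sup>3 = \<bar>t\<bar>\<^sup>3 / sqrt n\<close>.\<close>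

theorem path_sum_char_tendsto:
  fixes d :: "'s \<Rightarrow> 's \<Rightarrow> real"
  assumes irr: "irreducible_matrix P" and stat: "stationary_vector P \<pi>" and "centred d"
  defines "\<sigma>2 \<equiv> \<Sum>i\<in>UNIV. \<pi> $ i * (\<Sum>j\<in>UNIV. P $ i $ j * (d i j)\<^sup>2)"
  shows "(\<lambda>n. \<integral>\<omega>. iexp (t * (path_sum d n \<omega> / sqrt n)) \<partial>M) \<longlonglongrightarrow> exp (- (t\<^sup>2 * \<sigma>2 / 2))"
proof -
  obtain w where w: "w $ i - (P *v w) $ i =
      (\<Sum>j\<in>UNIV. P $ i $ j * (d i j)\<^sup>2) - \<sigma>2" for i
    using poisson_equation[OF stochastic irr stat, of "\<chi> i. \<Sum>j\<in>UNIV. P $ i $ j * (d i j)\<^sup>2"]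
    by (auto simp: \<sigma>2_def inner_vec_def)
  define K where "K = Max (range (\<lambda>(i, j). \<bar>d i j\<bar>))"
  define W where "W = Max (range (\<lambda>i. \<bar>w $ i\<bar>))"
  have K: "\<bar>d i j\<bar> \<le> K" for i j
    unfolding K_def by (intro Max_ge) (auto intro: rev_image_eqI[of "(i, j)"])
  have W: "\<bar>w $ i\<bar> \<le> W" for i
    unfolding W_def by (intro Max_ge) auto
  have \<sigma>2: "0 \<le> \<sigma>2"
    using stat P_nonneg by (auto simp: \<sigma>2_def stationary_vector_def intro!: sum_nonneg mult_nonneg_nonneg)
  define C where "C = K ^ 3 + W * K + \<sigma>2 * W"
  define \<theta> where "\<theta> n = t / sqrt (real n)" for n :: nat
  have \<theta>0: "\<theta> \<longlonglongrightarrow> 0"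
    unfolding \<theta>_def by real_asymp
  have "eventually (\<lambda>n. \<bar>\<theta> n\<bar> \<le> 1) sequentially"
  proof -
    have "eventually (\<lambda>n. \<bar>\<theta> n\<bar> < 1) sequentially"
      using tendsto_rabs_zero[OF \<theta>0] by (rule order_tendstoD) simp
    then show ?thesis
      by (rule eventually_mono) simp
  qed
  moreover have "eventually (\<lambda>n. (\<theta> n)\<^sup>2 * \<sigma>2 < 2) sequentially"
  proof -
    have "(\<lambda>n. (\<theta> n)\<^sup>2 * \<sigma>2) \<longlonglongrightarrow> 0"
      using \<theta>0 by (auto intro!: tendsto_eq_intros)
    then show ?thesis
      by (rule order_tendstoD) simp
  qed
  ultimately have bound: "eventually (\<lambda>n. cmod ((\<integral>\<omega>. iexp (\<theta> n * path_sum d n \<omega>) \<partial>M) -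
      (1 - (\<theta> n)\<^sup>2 * \<sigma>2 / 2) ^ n) \<le> W * (\<theta> n)\<^sup>2 + real n * (C * \<bar>\<theta> n\<bar> ^ 3)) sequentially"
  proof eventually_elim
    case (elim n)
    then show ?case
      using path_sum_char_approx[OF assms(3) K W w, of "\<theta> n" n] \<sigma>2 by (simp add: C_def)
  qed
  have n_cube: "real n * \<bar>\<theta> n\<bar> ^ 3 = \<bar>t\<bar> ^ 3 * (1 / sqrt (real n))" for n
    by (cases "n = 0") (auto simp: \<theta>_def power_divide power3_eq_cube field_simps)
  have "(\<lambda>n. 1 / sqrt (real n)) \<longlonglongrightarrow> 0"
    by real_asymp
  then have "(\<lambda>n. W * (\<theta> n)\<^sup>2 + C * (\<bar>t\<bar> ^ 3 * (1 / sqrt (real n)))) \<longlonglongrightarrow> W * 0\<^sup>2 + C * (\<bar>t\<bar> ^ 3 * 0)"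
    using \<theta>0 by (intro tendsto_add tendsto_mult tendsto_const tendsto_power)
  then have "(\<lambda>n. W * (\<theta> n)\<^sup>2 + C * (\<bar>t\<bar> ^ 3 * (1 / sqrt (real n)))) \<longlonglongrightarrow> 0"
    by simp
  then have "(\<lambda>n. W * (\<theta> n)\<^sup>2 + real n * (C * \<bar>\<theta> n\<bar> ^ 3)) \<longlonglongrightarrow> 0"
    by (simp only: n_cube[symmetric] mult.left_commute)
  from Lim_null_comparison[OF bound this]
  have 1: "(\<lambda>n. (\<integral>\<omega>. iexp (\<theta> n * path_sum d n \<omega>) \<partial>M) - (1 - (\<theta> n)\<^sup>2 * \<sigma>2 / 2) ^ n) \<longlonglongrightarrow> 0"
    by simp
  have "(\<lambda>n. (1 + (- (t\<^sup>2 * \<sigma>2 / 2)) / real n) ^ n) \<longlonglongrightarrow> exp (- (t\<^sup>2 * \<sigma>2 / 2))"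
    by (rule tendsto_exp_limit_sequentially)
  then have "(\<lambda>n. (1 - (\<theta> n)\<^sup>2 * \<sigma>2 / 2) ^ n) \<longlonglongrightarrow> exp (- (t\<^sup>2 * \<sigma>2 / 2))"
    by (simp add: \<theta>_def power_divide mult.commute)
  from tendsto_of_real[OF this, where 'a=complex]
  have "(\<lambda>n. (1 - complex_of_real ((\<theta> n)\<^sup>2 * \<sigma>2 / 2)) ^ n) \<longlonglongrightarrow> exp (- (t\<^sup>2 * \<sigma>2 / 2))"
    by simp
  from tendsto_add[OF 1 this] show ?thesis
    by (simp add: \<theta>_def)
qed

end

section \<open>Visit frequencies and transition excesses\<close>

lemma transition_count_sum:
  "real (transition_count X n \<omega> i j) = (\<Sum>m<n. of_bool (X m \<omega> = i \<and> X (Suc m) \<omega> = j))"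
proof -
  have "{m. m < n \<and> X m \<omega> = i \<and> X (Suc m) \<omega> = j} = {m \<in> {..<n}. X m \<omega> = i \<and> X (Suc m) \<omega> = j}"
    by auto
  then show ?thesis
    by (simp add: transition_count_def of_bool_def sum.If_cases Int_def)
qed

lemma visit_count_sum:
  "real (visit_count X n \<omega> i) = (\<Sum>m<n. of_bool (X m \<omega> = i))"
proof -
  have "(\<Sum>j\<in>UNIV. of_bool (X m \<omega> = i \<and> X (Suc m) \<omega> = j)) = (of_bool (X m \<omega> = i) :: real)" for m
    by (cases "X m \<omega> = i") (simp_all add: of_bool_def)
  then show ?thesis
    unfolding visit_count_def of_nat_sum transition_count_sum
    by (subst sum.swap) (simp only: )
qed

lemma stochastic_P_hat:
  assumes "\<And>i. 0 < visit_count X n \<omega> i"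
  shows "stochastic_matrix (P_hat X n \<omega>)"
proof -
  have "(\<Sum>j\<in>UNIV. real (transition_count X n \<omega> i j) / real (visit_count X n \<omega> i)) = 1" for i
  proof -
    have "(\<Sum>j\<in>UNIV. real (transition_count X n \<omega> i j)) = real (visit_count X n \<omega> i)"
      by (simp only: visit_count_def of_nat_sum)
    then show ?thesis
      using assms[of i] by (simp flip: sum_divide_distrib)
  qed
  then show ?thesis
    using assms by (simp add: stochastic_matrix_def P_hat_def less_imp_neq[symmetric])
qed

context markov_trajectory
begin

definition transition_excess :: "'s \<Rightarrow> 's \<Rightarrow> 's \<Rightarrow> 's \<Rightarrow> real" where
  "transition_excess i j k l = of_bool (k = i) * (of_bool (l = j) - P $ i $ j)"

lemma centred_transition_excess: "centred (transition_excess i j)"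
proof -
  have "(\<Sum>l\<in>UNIV. P $ k $ l * transition_excess i j k l) = 0" for k
  proof (cases "k = i")
    case True
    then have "(\<Sum>l\<in>UNIV. P $ k $ l * transition_excess i j k l) =
        (\<Sum>l\<in>UNIV. (if l = j then P $ i $ l else 0) - P $ i $ l * P $ i $ j)"
      by (intro sum.cong) (auto simp: transition_excess_def algebra_simps)
    also have "\<dots> = 0"
      by (simp add: sum_subtractf P_row_sum flip: sum_distrib_right)
    finally show ?thesis .
  qed (simp add: transition_excess_def)
  then show ?thesis
    by (simp add: centred_def)
qed

lemma P_le_1: "P $ i $ j \<le> 1"
  using member_le_sum[of j UNIV "\<lambda>j. P $ i $ j"] by (simp add: P_nonneg P_row_sum)

lemma transition_excess_le_1: "\<bar>transition_excess i j k l\<bar> \<le> 1"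
  using P_nonneg[of i j] P_le_1[of i j] by (auto simp: transition_excess_def of_bool_def)

lemma path_sum_transition_excess:
  "path_sum (transition_excess i j) n \<omega> =
    real (transition_count X n \<omega> i j) - real (visit_count X n \<omega> i) * P $ i $ j"
  unfolding path_sum_def transition_count_sum visit_count_sum sum_distrib_right sum_subtractf[symmetric]
  by (intro sum.cong refl) (simp add: transition_excess_def)

lemma visit_count_measurable [measurable]:
  "(\<lambda>\<omega>. real (visit_count X n \<omega> i)) \<in> borel_measurable M"
  unfolding visit_count_sum by measurable

text \<open>Summed along the trajectory, the Poisson equation for the indicator of \<open>i\<close> writes
  \<open>N_i(n) - n \<pi>_i\<close> as a centred path sum plus the telescoping term \<open>w(X_0) - w(X_n)\<close>. The former
  has second moment \<open>O(n)\<close> and the latter is bounded.\<close>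

lemma visit_frequency_tendsto_in_prob:
  assumes irr: "irreducible_matrix P" and stat: "stationary_vector P \<pi>" and "0 < \<delta>"
  shows "(\<lambda>n. prob {\<omega> \<in> space M. \<delta> \<le> \<bar>real (visit_count X n \<omega> i) / real n - \<pi> $ i\<bar>}) \<longlonglongrightarrow> 0"
proof -
  have indicator: "(axis i 1 :: real^'s) $ k = of_bool (k = i)" "\<pi> \<bullet> axis i 1 = \<pi> $ i" for k
    by (simp add: axis_def) (simp add: inner_axis)
  obtain w where w: "w $ k - (P *v w) $ k = of_bool (k = i) - \<pi> $ i" for k
    using poisson_equation[OF stochastic irr stat, of "axis i 1"] unfolding indicator by blast
  define d where "d k l = w $ l - (P *v w) $ k" for k l
  define K where "K = Max (range (\<lambda>(k, l). \<bar>d k l\<bar>))"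
  define W where "W = Max (range (\<lambda>k. \<bar>w $ k\<bar>))"
  have K: "\<bar>d k l\<bar> \<le> K" for k l
    unfolding K_def by (intro Max_ge) (auto intro: rev_image_eqI[of "(k, l)"])
  have W: "\<bar>w $ k\<bar> \<le> W" for k
    unfolding W_def by (intro Max_ge) auto
  have "centred d"
    by (simp add: centred_def d_def right_diff_distrib sum_subtractf P_row_sum matrix_vector_mult_def
        flip: sum_distrib_right)
  have telescope: "real (visit_count X n \<omega> i) - real n * \<pi> $ i =
      path_sum d n \<omega> + (w $ X 0 \<omega> - w $ X n \<omega>)" for n \<omega>
  proof (induction n)
    case (Suc n)
    then show ?case
      using w[of "X n \<omega>"] by (simp add: visit_count_sum path_sum_Suc d_def algebra_simps)
  qed (simp add: visit_count_sum)
  \<comment> \<open>Once \<open>n \<ge> 4 W / \<delta>\<close>, the telescoping term takes up at most half of the deviation \<open>n \<delta>\<close>.\<close>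
  have tail: "prob {\<omega> \<in> space M. \<delta> \<le> \<bar>real (visit_count X n \<omega> i) / real n - \<pi> $ i\<bar>} \<le>
      4 * K\<^sup>2 / \<delta>\<^sup>2 * (1 / real n)" if n: "0 < n" "4 * W / \<delta> \<le> real n" for n
  proof -
    have "{\<omega> \<in> space M. \<delta> \<le> \<bar>real (visit_count X n \<omega> i) / real n - \<pi> $ i\<bar>} \<subseteq>
        {\<omega> \<in> space M. real n * \<delta> / 2 \<le> \<bar>path_sum d n \<omega>\<bar>}"
    proof safe
      fix \<omega> assume "\<delta> \<le> \<bar>real (visit_count X n \<omega> i) / real n - \<pi> $ i\<bar>"
      then have "real n * \<delta> \<le> real n * \<bar>real (visit_count X n \<omega> i) / real n - \<pi> $ i\<bar>"
        by (intro mult_left_mono) auto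
      also have "\<dots> = \<bar>path_sum d n \<omega> + (w $ X 0 \<omega> - w $ X n \<omega>)\<bar>"
        using n(1) by (simp add: abs_mult_pos' right_diff_distrib flip: telescope)
      also have "\<dots> \<le> \<bar>path_sum d n \<omega>\<bar> + 2 * W"
        using W[of "X 0 \<omega>"] W[of "X n \<omega>"] by linarith
      also have "2 * W \<le> real n * \<delta> / 2"
        using n(2) \<open>0 < \<delta>\<close> by (simp add: field_simps)
      finally show "real n * \<delta> / 2 \<le> \<bar>path_sum d n \<omega>\<bar>"
        by simp
    qed
    then have "prob {\<omega> \<in> space M. \<delta> \<le> \<bar>real (visit_count X n \<omega> i) / real n - \<pi> $ i\<bar>} \<le>
        prob {\<omega> \<in> space M. real n * \<delta> / 2 \<le> \<bar>path_sum d n \<omega>\<bar>}"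
      by (intro finite_measure_mono) measurable
    also have "\<dots> \<le> real n * K\<^sup>2 / (real n * \<delta> / 2)\<^sup>2"
      using n \<open>0 < \<delta>\<close> by (intro centred_path_sum_tail \<open>centred d\<close> K) auto
    also have "\<dots> = 4 * K\<^sup>2 / \<delta>\<^sup>2 * (1 / real n)"
      using n \<open>0 < \<delta>\<close> by (simp add: field_simps power2_eq_square)
    finally show ?thesis .
  qed
  show ?thesis
  proof (rule tendsto_sandwich[of "\<lambda>_. 0"])
    have "eventually (\<lambda>n. 4 * W / \<delta> \<le> real n) sequentially"
      using filterlim_real_sequentially by (auto simp: filterlim_at_top)
    with eventually_gt_at_top[of "0::nat"]
    show "\<forall>\<^sub>F n in sequentially. prob {\<omega> \<in> space M. \<delta> \<le> \<bar>real (visit_count X n \<omega> i) / real n - \<pi> $ i\<bar>} \<le>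
        4 * K\<^sup>2 / \<delta>\<^sup>2 * (1 / real n)"
      by eventually_elim (rule tail)
    show "(\<lambda>n. 4 * K\<^sup>2 / \<delta>\<^sup>2 * (1 / real n)) \<longlonglongrightarrow> 0"
      by (intro tendsto_mult_right_zero lim_1_over_n)
  qed auto
qed

end

section \<open>The delta method\<close>

lemma norm_matrix_le_sum: "norm (H :: real^'n::finite^'m::finite) \<le> (\<Sum>i\<in>UNIV. \<Sum>j\<in>UNIV. \<bar>H $ i $ j\<bar>)"
proof -
  have "norm H \<le> (\<Sum>i\<in>UNIV. norm (H $ i))"
    unfolding norm_vec_def by (rule L2_set_le_sum) auto
  also have "\<dots> \<le> (\<Sum>i\<in>UNIV. \<Sum>j\<in>UNIV. \<bar>H $ i $ j\<bar>)"
    by (intro sum_mono norm_le_l1_cart)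
  finally show ?thesis .
qed

lemma linear_matrix_functional:
  fixes F' :: "real^'n::finite^'m::finite \<Rightarrow> real"
  assumes "linear F'"
  shows "F' H = (\<Sum>i\<in>UNIV. \<Sum>j\<in>UNIV. F' (axis i (axis j 1)) * H $ i $ j)"
proof -
  have "(axis x (axis y 1) :: real^'n^'m) $ i $ j = (if y = j then if x = i then 1 else 0 else 0)" for x y i j
    by (simp add: axis_def)
  then have "H = (\<Sum>i\<in>UNIV. \<Sum>j\<in>UNIV. H $ i $ j *\<^sub>R axis i (axis j 1))"
    by (simp add: vec_eq_iff if_distrib[of "\<lambda>z. _ * z"] cong: if_cong)
  then have "F' H = F' (\<Sum>i\<in>UNIV. \<Sum>j\<in>UNIV. H $ i $ j *\<^sub>R axis i (axis j 1))"
    by (rule arg_cong)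
  then show ?thesis
    by (simp add: linear_sum[OF assms] linear_scale[OF assms] mult.commute)
qed

text \<open>The delta method as a deterministic estimate, with \<open>\<nu>\<close>, \<open>E\<close> and \<open>Q\<close> in the place of the visit
  counts, the transition excesses and \<open>P_hat\<close>. The bounds on \<open>\<nu>\<close> and \<open>E\<close> put \<open>Q\<close> within
  \<open>O(1 / sqrt n)\<close> of \<open>P\<close>. Differentiability then makes the nonlinear part of
  \<open>sqrt n (F Q - F P)\<close> small for large \<open>n\<close>, and replacing \<open>n / \<nu> i\<close> by \<open>1 / \<pi> i\<close> in the linear part
  costs \<open>O(\<delta>)\<close>.\<close>

lemma delta_remainder_small:
  fixes P :: "real^'s::finite^'s" and \<pi> :: "real^'s" and F :: "real^'s^'s \<Rightarrow> real"
  assumes deriv: "(F has_derivative F') (at P)" and "open U" "P \<in> U"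
    and \<pi>: "\<And>i. 0 < \<pi> $ i" and "0 < \<epsilon>" "0 < b"
  obtains \<delta> n0 where "0 < \<delta>"
    "\<And>(n::nat) Q E \<nu>. n0 \<le> n \<Longrightarrow> (\<And>i. \<bar>\<nu> i / real n - \<pi> $ i\<bar> < \<delta>) \<Longrightarrow>
      (\<And>i j. \<bar>E i j\<bar> \<le> b * sqrt (real n)) \<Longrightarrow> (\<And>i j. 0 < \<nu> i \<Longrightarrow> Q $ i $ j = P $ i $ j + E i j / \<nu> i) \<Longrightarrow>
      (\<forall>i. 0 < \<nu> i) \<and> Q \<in> U \<and>
      \<bar>sqrt (real n) * (F Q - F P) -
        (\<Sum>i\<in>UNIV. \<Sum>j\<in>UNIV. F' (axis i (axis j 1)) / \<pi> $ i * E i j) / sqrt (real n)\<bar> < \<epsilon>"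
proof -
  define g where "g i j = F' (axis i (axis j 1))" for i j
  define p where "p = Min (range (($) \<pi>))"
  have p: "p \<le> \<pi> $ i" for i
    unfolding p_def by (intro Min_le) auto
  have "p \<in> range (($) \<pi>)"
    unfolding p_def by (intro Min_in) auto
  then have p0: "0 < p"
    using \<pi> by auto
  define G where "G = (\<Sum>i\<in>UNIV. \<Sum>j\<in>UNIV. \<bar>g i j\<bar>)"
  have G0: "0 \<le> G"
    by (auto simp: G_def intro!: sum_nonneg)
  \<comment> \<open>\<open>B / sqrt n\<close> bounds the norm of \<open>Q - P\<close>, because \<open>\<nu> i \<ge> n p / 2\<close>.\<close>
  define B where "B = (\<Sum>i\<in>(UNIV::'s set). \<Sum>j\<in>(UNIV::'s set). 2 * b / p)"
  have B0: "0 \<le> B"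
    using \<open>0 < b\<close> p0 by (auto simp: B_def intro!: sum_nonneg)
  \<comment> \<open>Half of \<open>\<epsilon>\<close> is spent on the nonlinear remainder (through \<open>e\<close>), half on the replacement of
    the visit frequencies by \<open>\<pi>\<close> (through \<open>\<delta>\<close>).\<close>
  define e where "e = \<epsilon> / (2 * (B + 1))"
  have e0: "0 < e"
    using B0 \<open>0 < \<epsilon>\<close> by (simp add: e_def)
  obtain r1 where r1: "0 < r1" "\<And>Q. norm (Q - P) < r1 \<Longrightarrow> \<bar>F Q - F P - F' (Q - P)\<bar> \<le> e * norm (Q - P)"
    using deriv e0 unfolding has_derivative_at_alt by (metis real_norm_def)
  obtain r2 where r2: "0 < r2" "ball P r2 \<subseteq> U"
    using \<open>open U\<close> \<open>P \<in> U\<close> open_contains_ball by blast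
  define r where "r = min r1 r2"
  have r0: "0 < r"
    using r1 r2 by (simp add: r_def)
  define \<delta> where "\<delta> = min (p / 2) (\<epsilon> * p\<^sup>2 / (4 * (G * b + 1)))"
  have \<delta>0: "0 < \<delta>"
    using p0 \<open>0 < \<epsilon>\<close> \<open>0 < b\<close> G0 by (auto simp: \<delta>_def intro!: divide_pos_pos mult_pos_pos add_nonneg_pos)
  have "eventually (\<lambda>n. B / sqrt (real n) < r) sequentially"
  proof -
    have "(\<lambda>n. B / sqrt (real n)) \<longlonglongrightarrow> 0"
      by real_asymp
    then show ?thesis
      using r0 by (rule order_tendstoD)
  qed
  then obtain n1 where n1: "\<And>n. n1 \<le> n \<Longrightarrow> B / sqrt (real n) < r"
    by (auto simp: eventually_sequentially)
  show thesis
  proof (rule that[of \<delta> "Suc n1"])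
    fix n :: nat and Q E \<nu>
    assume n: "Suc n1 \<le> n" and \<nu>: "\<And>i. \<bar>\<nu> i / real n - \<pi> $ i\<bar> < \<delta>"
      and E: "\<And>i j. \<bar>E i j\<bar> \<le> b * sqrt (real n)" and Q: "\<And>i j. 0 < \<nu> i \<Longrightarrow> Q $ i $ j = P $ i $ j + E i j / \<nu> i"
    let ?s = "sqrt (real n)"
    have n0: "0 < real n"
      using n by simp
    then have s0: "0 < ?s"
      by simp
    have ss: "real n = ?s * ?s"
      by simp
    have freq: "p / 2 \<le> \<nu> i / real n" for i
      using \<nu>[of i] p[of i] min.cobounded1[of "p / 2" "\<epsilon> * p\<^sup>2 / (4 * (G * b + 1))"]
      unfolding \<delta>_def abs_less_iff by linarith
    have \<nu>_pos: "0 < \<nu> i" for i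
      using less_le_trans[OF _ freq, of 0 i] p0 n0 by (simp add: zero_less_divide_iff)
    have H: "\<bar>(Q - P) $ i $ j\<bar> \<le> 2 * b / p / ?s" for i j
    proof -
      have "\<bar>(Q - P) $ i $ j\<bar> = \<bar>E i j\<bar> / real n / (\<nu> i / real n)"
        using n0 \<nu>_pos[of i] by (simp add: Q)
      also have "\<dots> \<le> (b * ?s) / real n / (p / 2)"
        using divide_right_mono[OF E[of i j], of "real n"] \<open>0 < b\<close> freq[of i] p0
        by - (rule frac_le, auto)
      also have "\<dots> = 2 * b / p / ?s"
        using n0 p0 by (subst ss) (simp add: field_simps)
      finally show ?thesis .
    qed
    have normH: "norm (Q - P) \<le> B / ?s"
    proof -
      have "norm (Q - P) \<le> (\<Sum>i\<in>UNIV. \<Sum>j\<in>UNIV. \<bar>(Q - P) $ i $ j\<bar>)"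
        by (rule norm_matrix_le_sum)
      also have "\<dots> \<le> (\<Sum>i\<in>(UNIV::'s set). \<Sum>j\<in>(UNIV::'s set). 2 * b / p / ?s)"
        by (intro sum_mono H)
      finally show ?thesis
        by (simp add: B_def)
    qed
    then have near: "norm (Q - P) < r"
      using n1[of n] n by simp
    then have "Q \<in> U"
      using r2 by (auto simp: r_def dist_norm norm_minus_commute)
    have "?s * \<bar>F Q - F P - F' (Q - P)\<bar> \<le> ?s * (e * (B / ?s))"
      using order_trans[OF r1(2) mult_left_mono[OF normH, of e]] near e0 s0
      by (intro mult_left_mono) (simp_all add: r_def)
    also have "\<dots> = e * B"
      using s0 by simp
    also have "\<dots> < \<epsilon> / 2"
      using B0 \<open>0 < \<epsilon>\<close> by (simp add: e_def field_simps)
    finally have nonlinear: "\<bar>?s * (F Q - F P) - ?s * F' (Q - P)\<bar> < \<epsilon> / 2"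
      using s0 by (simp add: abs_mult flip: right_diff_distrib)
    have entry: "\<bar>g i j * (?s * (E i j / \<nu> i)) - g i j / \<pi> $ i * E i j / ?s\<bar> \<le> \<bar>g i j\<bar> * (b * (2 * \<delta> / p\<^sup>2))" for i j
    proof -
      define x where "x = \<nu> i / real n"
      have x: "p / 2 \<le> x" "\<bar>\<pi> $ i - x\<bar> \<le> \<delta>" "\<nu> i = x * (?s * ?s)"
        using freq[of i] \<nu>[of i] n0 by (auto simp: x_def abs_minus_commute)
      have "x \<noteq> 0" "\<pi> $ i \<noteq> 0" "?s \<noteq> 0"
        using x p0 \<pi>[of i] s0 by auto
      then have "g i j * (?s * (E i j / \<nu> i)) - g i j / \<pi> $ i * E i j / ?s =
          g i j * ((E i j / ?s) * ((\<pi> $ i - x) / (\<pi> $ i * x)))"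
        unfolding x(3) by (simp add: field_simps del: real_sqrt_mult_self)
      also have "\<bar>\<dots>\<bar> = \<bar>g i j\<bar> * ((\<bar>E i j\<bar> / ?s) * (\<bar>\<pi> $ i - x\<bar> / (\<pi> $ i * x)))"
        using x p0 \<pi>[of i] by (simp add: abs_mult)
      also have "\<dots> \<le> \<bar>g i j\<bar> * (b * (\<delta> / (p * (p / 2))))"
        using x p0 p[of i] E[of i j] s0 \<open>0 < b\<close>
        by (intro mult_left_mono mult_mono frac_le) (auto simp: divide_le_eq)
      finally show ?thesis
        using p0 by (simp add: power2_eq_square mult.commute[of \<delta>])
    qed
    have lin: "linear F'"
      using deriv by (rule has_derivative_linear)
    have "?s * F' (Q - P) - (\<Sum>i\<in>UNIV. \<Sum>j\<in>UNIV. g i j / \<pi> $ i * E i j) / ?s =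
        (\<Sum>i\<in>UNIV. \<Sum>j\<in>UNIV. g i j * (?s * (E i j / \<nu> i)) - g i j / \<pi> $ i * E i j / ?s)"
      using \<nu>_pos
      by (subst linear_matrix_functional[OF lin])
        (simp add: Q g_def sum_subtractf sum_distrib_left sum_divide_distrib mult_ac)
    also have "\<bar>\<dots>\<bar> \<le> (\<Sum>i\<in>UNIV. \<Sum>j\<in>UNIV. \<bar>g i j\<bar> * (b * (2 * \<delta> / p\<^sup>2)))"
      by (rule order_trans[OF sum_abs], rule sum_mono, rule order_trans[OF sum_abs], rule sum_mono, rule entry)
    also have "\<dots> = G * b * (2 * \<delta> / p\<^sup>2)"
      unfolding G_def sum_distrib_right by (simp only: mult.assoc)
    also have "\<dots> \<le> (G * b + 1) * (2 * \<delta> / p\<^sup>2)"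
      using \<delta>0 p0 by (intro mult_right_mono) auto
    also have "\<dots> \<le> (G * b + 1) * (2 * (\<epsilon> * p\<^sup>2 / (4 * (G * b + 1))) / p\<^sup>2)"
      using p0 G0 \<open>0 < b\<close> by (intro mult_left_mono divide_right_mono) (auto simp: \<delta>_def)
    also have "\<dots> = \<epsilon> / 2"
    proof -
      have "G * b + 1 \<noteq> 0"
        using G0 \<open>0 < b\<close> by (intro less_imp_neq[symmetric] add_nonneg_pos) auto
      then show ?thesis
        using p0 by (simp add: divide_simps)
    qed
    finally have "\<bar>?s * F' (Q - P) - (\<Sum>i\<in>UNIV. \<Sum>j\<in>UNIV. g i j / \<pi> $ i * E i j) / ?s\<bar> \<le> \<epsilon> / 2" .
    with nonlinear have "\<bar>?s * (F Q - F P) - (\<Sum>i\<in>UNIV. \<Sum>j\<in>UNIV. g i j / \<pi> $ i * E i j) / ?s\<bar> < \<epsilon>"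
      by linarith
    with \<nu>_pos \<open>Q \<in> U\<close> show "(\<forall>i. 0 < \<nu> i) \<and> Q \<in> U \<and>
      \<bar>?s * (F Q - F P) - (\<Sum>i\<in>UNIV. \<Sum>j\<in>UNIV. F' (axis i (axis j 1)) / \<pi> $ i * E i j) / ?s\<bar> < \<epsilon>"
      by (simp add: g_def)
  qed (rule \<delta>0)
qed

text \<open>Slutsky's theorem for characteristic functions: a perturbation that tends to zero in
  probability does not change the limit, because \<open>x \<mapsto> exp (i t x)\<close> is bounded and Lipschitz.\<close>

lemma (in prob_space) char_tendsto_perturb:
  fixes Y Z :: "nat \<Rightarrow> 'a \<Rightarrow> real"
  assumes [measurable]: "\<And>n. Y n \<in> borel_measurable M" "\<And>n. Z n \<in> borel_measurable M"
    and near: "\<And>\<epsilon>. 0 < \<epsilon> \<Longrightarrow> (\<lambda>n. prob {\<omega> \<in> space M. \<epsilon> \<le> \<bar>Y n \<omega> - Z n \<omega>\<bar>}) \<longlonglongrightarrow> 0"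
    and lim: "(\<lambda>n. \<integral>\<omega>. iexp (t * Z n \<omega>) \<partial>M) \<longlonglongrightarrow> l"
  shows "(\<lambda>n. \<integral>\<omega>. iexp (t * Y n \<omega>) \<partial>M) \<longlonglongrightarrow> l"
proof -
  have bound: "cmod ((\<integral>\<omega>. iexp (t * Y n \<omega>) \<partial>M) - (\<integral>\<omega>. iexp (t * Z n \<omega>) \<partial>M)) \<le>
      \<bar>t\<bar> * \<epsilon> + 2 * prob {\<omega> \<in> space M. \<epsilon> \<le> \<bar>Y n \<omega> - Z n \<omega>\<bar>}" if "0 < \<epsilon>" for n \<epsilon>
  proof -
    let ?A = "{\<omega> \<in> space M. \<epsilon> \<le> \<bar>Y n \<omega> - Z n \<omega>\<bar>}"
    have int: "integrable M (\<lambda>\<omega>. iexp (t * V \<omega>))" if [measurable]: "V \<in> borel_measurable M" for V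
      by (rule integrable_const_bound[of _ 1]) auto
    have "(\<integral>\<omega>. iexp (t * Y n \<omega>) \<partial>M) - (\<integral>\<omega>. iexp (t * Z n \<omega>) \<partial>M) =
        (\<integral>\<omega>. iexp (t * Y n \<omega>) - iexp (t * Z n \<omega>) \<partial>M)"
      by (rule Bochner_Integration.integral_diff[symmetric]) (rule int, measurable)+
    also have "cmod \<dots> \<le> (\<integral>\<omega>. cmod (iexp (t * Y n \<omega>) - iexp (t * Z n \<omega>)) \<partial>M)"
      by (rule integral_norm_bound)
    also have "\<dots> \<le> (\<integral>\<omega>. \<bar>t\<bar> * \<epsilon> + 2 * indicator ?A \<omega> \<partial>M)"
    proof (rule integral_mono)
      show "integrable M (\<lambda>\<omega>. cmod (iexp (t * Y n \<omega>) - iexp (t * Z n \<omega>)))"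
        by (intro integrable_norm Bochner_Integration.integrable_diff int) measurable
      show "integrable M (\<lambda>\<omega>. \<bar>t\<bar> * \<epsilon> + 2 * indicator ?A \<omega>)"
        by (intro Bochner_Integration.integrable_add integrable_mult_right)
          (auto simp: less_top[symmetric])
      fix \<omega> assume \<omega>: "\<omega> \<in> space M"
      have "iexp (t * Y n \<omega>) - iexp (t * Z n \<omega>) = iexp (t * Z n \<omega>) * (iexp (t * (Y n \<omega> - Z n \<omega>)) - 1)"
        by (simp add: algebra_simps flip: exp_add)
      then have "cmod (iexp (t * Y n \<omega>) - iexp (t * Z n \<omega>)) = cmod (iexp (t * (Y n \<omega> - Z n \<omega>)) - 1)"
        by (simp only: norm_mult norm_exp_i_times mult_1)
      also have "\<dots> \<le> \<bar>t * (Y n \<omega> - Z n \<omega>)\<bar>"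
        using iexp_approx1[of "t * (Y n \<omega> - Z n \<omega>)" 0] by simp
      finally have lipschitz: "cmod (iexp (t * Y n \<omega>) - iexp (t * Z n \<omega>)) \<le> \<bar>t\<bar> * \<bar>Y n \<omega> - Z n \<omega>\<bar>"
        by (simp only: abs_mult)
      show "cmod (iexp (t * Y n \<omega>) - iexp (t * Z n \<omega>)) \<le> \<bar>t\<bar> * \<epsilon> + 2 * indicator ?A \<omega>"
      proof (cases "\<omega> \<in> ?A")
        case True
        have "cmod (iexp (t * Y n \<omega>) - iexp (t * Z n \<omega>)) \<le> 1 + 1"
          by (rule order_trans[OF norm_triangle_ineq4]) (simp only: norm_exp_i_times order_refl)
        moreover have "0 \<le> \<bar>t\<bar> * \<epsilon>"
          using that by simp
        ultimately show ?thesis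
          using True by simp
      next
        case False
        then have "\<bar>t\<bar> * \<bar>Y n \<omega> - Z n \<omega>\<bar> \<le> \<bar>t\<bar> * \<epsilon>"
          using \<omega> by (intro mult_left_mono) auto
        with lipschitz False show ?thesis
          by simp
      qed
    qed
    also have "\<dots> = \<bar>t\<bar> * \<epsilon> + 2 * prob ?A"
      by (subst Bochner_Integration.integral_add) (auto simp: prob_space less_top[symmetric])
    finally show ?thesis .
  qed
  have "(\<lambda>n. (\<integral>\<omega>. iexp (t * Y n \<omega>) \<partial>M) - (\<integral>\<omega>. iexp (t * Z n \<omega>) \<partial>M)) \<longlonglongrightarrow> 0"
  proof (rule tendstoI)
    fix e :: real assume "0 < e"
    define \<epsilon> where "\<epsilon> = e / (2 * (\<bar>t\<bar> + 1))"
    have \<epsilon>: "0 < \<epsilon>" "\<bar>t\<bar> * \<epsilon> < e / 2"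
      using \<open>0 < e\<close> by (auto simp: \<epsilon>_def field_simps intro!: divide_pos_pos add_nonneg_pos)
    have "eventually (\<lambda>n. prob {\<omega> \<in> space M. \<epsilon> \<le> \<bar>Y n \<omega> - Z n \<omega>\<bar>} < e / 4) sequentially"
      using near[OF \<epsilon>(1)] \<open>0 < e\<close> by (intro order_tendstoD) auto
    then show "eventually (\<lambda>n. dist ((\<integral>\<omega>. iexp (t * Y n \<omega>) \<partial>M) - (\<integral>\<omega>. iexp (t * Z n \<omega>) \<partial>M)) 0 < e) sequentially"
    proof eventually_elim
      case (elim n)
      then show ?case
        unfolding dist_0_norm dist_commute[of _ 0] using bound[OF \<epsilon>(1), of n] \<epsilon>(2) by linarith
    qed
  qed
  from tendsto_add[OF this lim] show ?thesis
    by simp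
qed

section \<open>Gaussian laws and covariance matrices\<close>

text \<open>A nondegenerate law is reduced to the standard normal law by an affine change of variable;
  for \<open>\<sigma> = 0\<close> the variable is almost surely constant.\<close>

lemma gaussian_law_moments:
  assumes "prob_space N" and V [measurable]: "V \<in> borel_measurable N" and "0 \<le> \<sigma>"
    and law: "distr N borel V = gaussian_law \<mu> \<sigma>"
  shows "integrable N V" "integrable N (\<lambda>\<omega>. (V \<omega>)\<^sup>2)"
    "(\<integral>\<omega>. V \<omega> \<partial>N) = \<mu>" "(\<integral>\<omega>. (V \<omega> - \<mu>)\<^sup>2 \<partial>N) = \<sigma>\<^sup>2"
    "(\<integral>\<omega>. iexp (t * V \<omega>) \<partial>N) = iexp (t * \<mu>) * exp (- (t\<^sup>2 * \<sigma>\<^sup>2 / 2))"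
proof -
  interpret prob_space N by fact
  have "integrable N V \<and> integrable N (\<lambda>\<omega>. (V \<omega>)\<^sup>2) \<and> (\<integral>\<omega>. V \<omega> \<partial>N) = \<mu> \<and>
    (\<integral>\<omega>. (V \<omega> - \<mu>)\<^sup>2 \<partial>N) = \<sigma>\<^sup>2 \<and>
    (\<integral>\<omega>. iexp (t * V \<omega>) \<partial>N) = iexp (t * \<mu>) * exp (- (t\<^sup>2 * \<sigma>\<^sup>2 / 2))"
  proof (cases "\<sigma> = 0")
    case True
    have "distr N borel V = return borel \<mu>"
      using law True unfolding gaussian_law_def by simp
    moreover have "AE x in return borel \<mu>. x = \<mu>"
      by (subst AE_return) auto
    ultimately have "AE x in distr N borel V. x = \<mu>"
      by (simp only: )
    then have AE: "AE \<omega> in N. V \<omega> = \<mu>"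
      by (subst (asm) AE_distr_iff) auto
    have eq: "integral\<^sup>L N (\<lambda>\<omega>. f (V \<omega>)) = f \<mu> \<and> integrable N (\<lambda>\<omega>. f (V \<omega>))"
      if [measurable]: "f \<in> borel_measurable borel" for f :: "real \<Rightarrow> 'x::{banach, second_countable_topology}"
    proof -
      have "AE \<omega> in N. f (V \<omega>) = f \<mu>"
        using AE by eventually_elim simp
      then have "integral\<^sup>L N (\<lambda>\<omega>. f (V \<omega>)) = integral\<^sup>L N (\<lambda>\<omega>. f \<mu>)"
        and "integrable N (\<lambda>\<omega>. f (V \<omega>)) = integrable N (\<lambda>\<omega>. f \<mu>)"
        by (intro integral_cong_AE integrable_cong_AE; simp)+
      then show ?thesis
        by (simp add: prob_space)
    qed
    show ?thesis
      using eq[of "\<lambda>x. x"] eq[of "\<lambda>x. x\<^sup>2"] eq[of "\<lambda>x. (x - \<mu>)\<^sup>2"] eq[of "\<lambda>x. iexp (t * x)"] True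
      by simp
  next
    case False
    with \<open>0 \<le> \<sigma>\<close> have \<sigma>: "0 < \<sigma>" by simp
    have "distr N lborel V = distr N borel V"
      by (rule distr_cong) auto
    then have V_normal: "distributed N lborel V (\<lambda>x. ennreal (normal_density \<mu> \<sigma> x))"
      using law False by (auto simp: distributed_def gaussian_law_def)
    have "integrable lborel (\<lambda>x. normal_density \<mu> \<sigma> x * x)"
      using \<sigma> by (rule integrable_normal_moment_nz_1)
    then have int: "integrable N V"
      using distributed_integrable[OF V_normal, of "\<lambda>x. x"] by simp
    have "integrable lborel (\<lambda>x. normal_density \<mu> \<sigma> x * (x - \<mu>)\<^sup>2)"
      using \<sigma> by (rule integrable_normal_moment)
    then have "integrable N (\<lambda>\<omega>. (V \<omega> - \<mu>)\<^sup>2)"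
      using distributed_integrable[OF V_normal, of "\<lambda>x. (x - \<mu>)\<^sup>2"] by simp
    then have "integrable N (\<lambda>\<omega>. (V \<omega> - \<mu>)\<^sup>2 + (2 * \<mu> * V \<omega> - \<mu>\<^sup>2))"
      using int by (intro Bochner_Integration.integrable_add Bochner_Integration.integrable_diff) auto
    then have int2: "integrable N (\<lambda>\<omega>. (V \<omega>)\<^sup>2)"
      by (simp add: power2_eq_square algebra_simps)
    have mean: "(\<integral>\<omega>. V \<omega> \<partial>N) = \<mu>"
      using V_normal \<sigma> by (intro normal_distributed_expectation)
    have var: "(\<integral>\<omega>. (V \<omega> - \<mu>)\<^sup>2 \<partial>N) = \<sigma>\<^sup>2"
      using normal_distributed_variance[OF \<sigma> V_normal] mean by simp
    have "distributed N lborel (\<lambda>\<omega>. (V \<omega> - \<mu>) / \<sigma>) std_normal_density"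
      using normal_standard_normal_convert[OF \<sigma>] V_normal by blast
    then have std: "std_normal_distribution = distr N lborel (\<lambda>\<omega>. (V \<omega> - \<mu>) / \<sigma>)"
      by (simp add: distributed_def)
    have "char std_normal_distribution (t * \<sigma>) = (\<integral>\<omega>. iexp (t * \<sigma> * ((V \<omega> - \<mu>) / \<sigma>)) \<partial>N)"
      unfolding std char_def by (subst integral_distr) auto
    moreover have "iexp (t * V \<omega>) = iexp (t * \<mu>) * iexp (t * \<sigma> * ((V \<omega> - \<mu>) / \<sigma>))" for \<omega>
    proof -
      have "t * V \<omega> = t * \<mu> + t * \<sigma> * ((V \<omega> - \<mu>) / \<sigma>)"
        using \<sigma> by (simp add: field_simps)
      then show ?thesis
        by (simp only: of_real_add distrib_left exp_add)
    qed
    ultimately have char: "(\<integral>\<omega>. iexp (t * V \<omega>) \<partial>N) = iexp (t * \<mu>) * exp (- (t\<^sup>2 * \<sigma>\<^sup>2 / 2))"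
      by (simp only: integral_mult_right_zero char_std_normal_distribution)
        (simp add: power_mult_distrib flip: exp_of_real)
    show ?thesis
      using int int2 mean var char by blast
  qed
  then show "integrable N V" "integrable N (\<lambda>\<omega>. (V \<omega>)\<^sup>2)" "(\<integral>\<omega>. V \<omega> \<partial>N) = \<mu>"
    "(\<integral>\<omega>. (V \<omega> - \<mu>)\<^sup>2 \<partial>N) = \<sigma>\<^sup>2"
    "(\<integral>\<omega>. iexp (t * V \<omega>) \<partial>N) = iexp (t * \<mu>) * exp (- (t\<^sup>2 * \<sigma>\<^sup>2 / 2))"
    by blast+
qed

lemma gaussian_element_square_integrable:
  assumes "gaussian_element N W"
  shows "integrable N (\<lambda>\<omega>. u \<bullet> W \<omega>)" "integrable N (\<lambda>\<omega>. (u \<bullet> W \<omega>)\<^sup>2)"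
proof -
  have [measurable]: "W \<in> borel_measurable N" and N: "prob_space N"
    using assms by (auto simp: gaussian_element_def)
  obtain \<mu> \<sigma> where "0 \<le> \<sigma>" "distr N borel (\<lambda>\<omega>. u \<bullet> W \<omega>) = gaussian_law \<mu> \<sigma>"
    using assms unfolding gaussian_element_def by blast
  note law = gaussian_law_moments(1,2)[OF N _ this]
  show "integrable N (\<lambda>\<omega>. u \<bullet> W \<omega>)" "integrable N (\<lambda>\<omega>. (u \<bullet> W \<omega>)\<^sup>2)"
    by (rule law, measurable)+
qed

lemma covariance_sum:
  fixes Y :: "'i \<Rightarrow> 'b \<Rightarrow> real" and Z :: "'j \<Rightarrow> 'b \<Rightarrow> real"
  assumes N: "prob_space N" and "finite I" "finite J"
    and Y: "\<And>i. i \<in> I \<Longrightarrow> integrable N (Y i)" "\<And>i. i \<in> I \<Longrightarrow> integrable N (\<lambda>\<omega>. (Y i \<omega>)\<^sup>2)"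
    and Z: "\<And>j. j \<in> J \<Longrightarrow> integrable N (Z j)" "\<And>j. j \<in> J \<Longrightarrow> integrable N (\<lambda>\<omega>. (Z j \<omega>)\<^sup>2)"
  shows "covariance N (\<lambda>\<omega>. \<Sum>i\<in>I. x i * Y i \<omega>) (\<lambda>\<omega>. \<Sum>j\<in>J. y j * Z j \<omega>) =
    (\<Sum>i\<in>I. \<Sum>j\<in>J. x i * y j * covariance N (Y i) (Z j))"
proof -
  interpret prob_space N by fact
  have centre: "integrable N (\<lambda>\<omega>. (V \<omega> - c)\<^sup>2)" if "integrable N V" "integrable N (\<lambda>\<omega>. (V \<omega>)\<^sup>2)"
    for V :: "'b \<Rightarrow> real" and c
  proof -
    have "integrable N (\<lambda>\<omega>. (V \<omega>)\<^sup>2 - 2 * c * V \<omega> + c\<^sup>2)"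
      using that by (intro Bochner_Integration.integrable_add Bochner_Integration.integrable_diff) auto
    then show ?thesis
      by (simp add: power2_eq_square algebra_simps)
  qed
  let ?Y = "\<lambda>i \<omega>. Y i \<omega> - (\<integral>\<eta>. Y i \<eta> \<partial>N)" and ?Z = "\<lambda>j \<omega>. Z j \<omega> - (\<integral>\<eta>. Z j \<eta> \<partial>N)"
  have int: "integrable N (\<lambda>\<omega>. ?Y i \<omega> * ?Z j \<omega>)" if ij: "i \<in> I" "j \<in> J" for i j
  proof (rule Bochner_Integration.integrable_bound)
    show "integrable N (\<lambda>\<omega>. (?Y i \<omega>)\<^sup>2 + (?Z j \<omega>)\<^sup>2)"
      using centre Y Z ij by (intro Bochner_Integration.integrable_add) auto
    have "\<bar>a * b\<bar> \<le> a\<^sup>2 + b\<^sup>2" for a b :: real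
    proof -
      have "2 * (\<bar>a\<bar> * \<bar>b\<bar>) \<le> a\<^sup>2 + b\<^sup>2"
        using sum_squares_bound[of "\<bar>a\<bar>" "\<bar>b\<bar>"] by simp
      moreover have "0 \<le> \<bar>a\<bar> * \<bar>b\<bar>"
        by simp
      ultimately show ?thesis
        unfolding abs_mult by linarith
    qed
    then show "AE \<omega> in N. norm (?Y i \<omega> * ?Z j \<omega>) \<le> norm ((?Y i \<omega>)\<^sup>2 + (?Z j \<omega>)\<^sup>2)"
      by (intro AE_I2) simp
    show "(\<lambda>\<omega>. ?Y i \<omega> * ?Z j \<omega>) \<in> borel_measurable N"
      using Y Z ij by (auto intro!: borel_measurable_times borel_measurable_diff borel_measurable_integrable)
  qed
  have EY: "(\<integral>\<omega>. (\<Sum>i\<in>I. x i * Y i \<omega>) \<partial>N) = (\<Sum>i\<in>I. x i * (\<integral>\<omega>. Y i \<omega> \<partial>N))"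
    using Y by (subst Bochner_Integration.integral_sum) auto
  have EZ: "(\<integral>\<omega>. (\<Sum>j\<in>J. y j * Z j \<omega>) \<partial>N) = (\<Sum>j\<in>J. y j * (\<integral>\<omega>. Z j \<omega> \<partial>N))"
    using Z by (subst Bochner_Integration.integral_sum) auto
  have "covariance N (\<lambda>\<omega>. \<Sum>i\<in>I. x i * Y i \<omega>) (\<lambda>\<omega>. \<Sum>j\<in>J. y j * Z j \<omega>) =
      (\<integral>\<omega>. (\<Sum>i\<in>I. \<Sum>j\<in>J. x i * y j * (?Y i \<omega> * ?Z j \<omega>)) \<partial>N)"
    unfolding covariance_def EY EZ
    by (intro Bochner_Integration.integral_cong refl)
      (simp add: sum_product mult_ac flip: sum_subtractf right_diff_distrib)
  also have "\<dots> = (\<Sum>i\<in>I. \<Sum>j\<in>J. x i * y j * (\<integral>\<omega>. ?Y i \<omega> * ?Z j \<omega> \<partial>N))"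
  proof -
    have "has_bochner_integral N (\<lambda>\<omega>. \<Sum>i\<in>I. \<Sum>j\<in>J. x i * y j * (?Y i \<omega> * ?Z j \<omega>))
        (\<Sum>i\<in>I. \<Sum>j\<in>J. x i * y j * (\<integral>\<omega>. ?Y i \<omega> * ?Z j \<omega> \<partial>N))"
      using int by (intro has_bochner_integral_sum has_bochner_integral_mult_right has_bochner_integral_integrable)
    then show ?thesis
      by (rule has_bochner_integral_integral_eq)
  qed
  finally show ?thesis
    by (simp add: covariance_def)
qed

lemma covariance_matrix_linear_image:
  fixes Y :: "'b \<Rightarrow> real^'n::finite" and L :: "real^'n^'m::finite"
  assumes "prob_space N" and "\<And>a. integrable N (\<lambda>\<omega>. Y \<omega> $ a)" "\<And>a. integrable N (\<lambda>\<omega>. (Y \<omega> $ a)\<^sup>2)"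
  shows "covariance_matrix N (\<lambda>\<omega>. L *v Y \<omega>) = L ** covariance_matrix N Y ** transpose L"
proof -
  have "covariance N (\<lambda>\<omega>. (L *v Y \<omega>) $ a) (\<lambda>\<omega>. (L *v Y \<omega>) $ b) =
      (\<Sum>p\<in>UNIV. \<Sum>q\<in>UNIV. L $ a $ p * L $ b $ q * covariance N (\<lambda>\<omega>. Y \<omega> $ p) (\<lambda>\<omega>. Y \<omega> $ q))" for a b
    unfolding matrix_vector_mult_def vec_lambda_beta by (rule covariance_sum) (use assms in auto)
  moreover have "(\<Sum>p\<in>UNIV. \<Sum>q\<in>UNIV. L $ a $ p * L $ b $ q * covariance N (\<lambda>\<omega>. Y \<omega> $ p) (\<lambda>\<omega>. Y \<omega> $ q)) =
      (L ** covariance_matrix N Y ** transpose L) $ a $ b" for a b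
    by (subst sum.swap)
      (simp add: matrix_matrix_mult_def covariance_matrix_def transpose_def sum_distrib_left sum_distrib_right mult_ac)
  ultimately show ?thesis
    by (simp add: vec_eq_iff covariance_matrix_def)
qed

section \<open>The limit law of a scalar characteristic\<close>

context markov_trajectory
begin

text \<open>For a linear functional with coefficients \<open>g\<close>, the contribution of a single transition from
  \<open>i\<close> to \<open>j\<close> to the leading term of the estimation error: the centred coefficient, weighted with
  the inverse of the visit frequency of \<open>i\<close>.\<close>

definition influence :: "real^'s \<Rightarrow> ('s \<Rightarrow> 's \<Rightarrow> real) \<Rightarrow> 's \<Rightarrow> 's \<Rightarrow> real" where
  "influence \<pi> g i j = (g i j - (\<Sum>l\<in>UNIV. P $ i $ l * g i l)) / \<pi> $ i"

lemma centred_influence: "centred (influence \<pi> g)"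
proof -
  have "(\<Sum>j\<in>UNIV. P $ i $ j * influence \<pi> g i j) =
      (\<Sum>j\<in>UNIV. P $ i $ j * g i j - P $ i $ j * (\<Sum>l\<in>UNIV. P $ i $ l * g i l)) / \<pi> $ i" for i
    unfolding sum_divide_distrib
    by (intro sum.cong refl) (simp add: influence_def right_diff_distrib)
  then show ?thesis
    by (simp add: centred_def sum_subtractf P_row_sum flip: sum_distrib_right)
qed

lemma path_sum_influence:
  "path_sum (influence \<pi> g) n \<omega> =
    (\<Sum>i\<in>UNIV. \<Sum>j\<in>UNIV. g i j / \<pi> $ i * path_sum (transition_excess i j) n \<omega>)"
proof -
  have "influence \<pi> g k l = (\<Sum>i\<in>UNIV. \<Sum>j\<in>UNIV. g i j / \<pi> $ i * transition_excess i j k l)" for k l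
  proof -
    have "(\<Sum>j\<in>UNIV. g i j / \<pi> $ i * transition_excess i j k l) =
        (if i = k then influence \<pi> g k l else 0)" for i
    proof (cases "i = k")
      case True
      have "(\<Sum>j\<in>UNIV. g k j / \<pi> $ k * transition_excess k j k l) =
          (\<Sum>j\<in>UNIV. ((if l = j then g k j else 0) - P $ k $ j * g k j) / \<pi> $ k)"
        by (intro sum.cong refl) (auto simp: transition_excess_def algebra_simps diff_divide_distrib)
      with True show ?thesis
        by (simp add: influence_def sum_subtractf flip: sum_divide_distrib)
    qed (simp add: transition_excess_def)
    then show ?thesis
      by simp
  qed
  then have "path_sum (influence \<pi> g) n \<omega> = (\<Sum>m<n. \<Sum>i\<in>UNIV. \<Sum>j\<in>UNIV.
      g i j / \<pi> $ i * transition_excess i j (X m \<omega>) (X (Suc m) \<omega>))"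
    by (simp only: path_sum_def)
  also have "\<dots> = (\<Sum>i\<in>UNIV. \<Sum>m<n. \<Sum>j\<in>UNIV.
      g i j / \<pi> $ i * transition_excess i j (X m \<omega>) (X (Suc m) \<omega>))"
    by (rule sum.swap)
  also have "\<dots> = (\<Sum>i\<in>UNIV. \<Sum>j\<in>UNIV. g i j / \<pi> $ i * path_sum (transition_excess i j) n \<omega>)"
    unfolding path_sum_def sum_distrib_left by (intro sum.cong refl sum.swap)
  finally show ?thesis .
qed

text \<open>Both sides are \<open>\<Sum>i. Var_i / \<pi>_i\<close>, where \<open>Var_i\<close> is the variance of \<open>g i\<close> under row \<open>i\<close> of \<open>P\<close>:
  the asymptotic variance along the trajectory is the quadratic form of \<open>Sigma_p\<close>.\<close>

lemma influence_variance:
  assumes "\<And>i. 0 < \<pi> $ i"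
  shows "(\<Sum>i\<in>UNIV. \<pi> $ i * (\<Sum>j\<in>UNIV. P $ i $ j * (influence \<pi> g i j)\<^sup>2)) =
    (\<Sum>p\<in>UNIV. \<Sum>q\<in>UNIV. g (fst p) (snd p) * g (fst q) (snd q) * Sigma_p P \<pi> $ p $ q)"
proof -
  define m where "m i = (\<Sum>l\<in>UNIV. P $ i $ l * g i l)" for i
  have left: "\<pi> $ i * (\<Sum>j\<in>UNIV. P $ i $ j * (influence \<pi> g i j)\<^sup>2) =
      ((\<Sum>j\<in>UNIV. P $ i $ j * (g i j)\<^sup>2) - (m i)\<^sup>2) / \<pi> $ i" for i
  proof -
    have influence: "influence \<pi> g i j = (g i j - m i) / \<pi> $ i" for j
      by (simp add: influence_def m_def)
    have "\<pi> $ i * (P $ i $ j * (influence \<pi> g i j)\<^sup>2) =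
        (P $ i $ j * (g i j)\<^sup>2 - 2 * m i * (P $ i $ j * g i j) + (m i)\<^sup>2 * P $ i $ j) / \<pi> $ i" for j
      unfolding influence using assms[of i] by (simp add: power2_eq_square field_simps)
    then have "\<pi> $ i * (\<Sum>j\<in>UNIV. P $ i $ j * (influence \<pi> g i j)\<^sup>2) =
        (\<Sum>j\<in>UNIV. P $ i $ j * (g i j)\<^sup>2 - 2 * m i * (P $ i $ j * g i j) + (m i)\<^sup>2 * P $ i $ j) / \<pi> $ i"
      by (simp only: sum_distrib_left sum_divide_distrib)
    then show ?thesis
      by (simp add: sum.distrib sum_subtractf P_row_sum power2_eq_square flip: sum_distrib_left m_def)
  qed
  have pairs: "(\<Sum>p\<in>UNIV. f p) = (\<Sum>i\<in>UNIV. \<Sum>j\<in>UNIV. f (i, j))" for f :: "'s \<times> 's \<Rightarrow> real"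
    using sum.cartesian_product[of "\<lambda>i j. f (i, j)" UNIV UNIV] by simp
  have right: "(\<Sum>j\<in>UNIV. \<Sum>k\<in>UNIV. \<Sum>l\<in>UNIV. g i j * g k l * Sigma_p P \<pi> $ (i, j) $ (k, l)) =
      ((\<Sum>j\<in>UNIV. P $ i $ j * (g i j)\<^sup>2) - (m i)\<^sup>2) / \<pi> $ i" for i
  proof -
    have "(\<Sum>k\<in>UNIV. \<Sum>l\<in>UNIV. g i j * g k l * Sigma_p P \<pi> $ (i, j) $ (k, l)) =
        (P $ i $ j * (g i j)\<^sup>2 - P $ i $ j * g i j * m i) / \<pi> $ i" for j
    proof -
      have "(\<Sum>k\<in>UNIV. \<Sum>l\<in>UNIV. g i j * g k l * Sigma_p P \<pi> $ (i, j) $ (k, l)) =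
          (\<Sum>k\<in>{i}. \<Sum>l\<in>UNIV. g i j * g k l * Sigma_p P \<pi> $ (i, j) $ (k, l))"
        by (rule sum.mono_neutral_right) (auto simp: Sigma_p_def)
      also have "\<dots> = (\<Sum>l\<in>UNIV. g i j * g i l * Sigma_p P \<pi> $ (i, j) $ (i, l))"
        by simp
      also have "\<dots> = (\<Sum>l\<in>UNIV. ((if j = l then P $ i $ j * g i j * g i l else 0) -
          P $ i $ j * g i j * (P $ i $ l * g i l)) / \<pi> $ i)"
        by (intro sum.cong refl) (simp add: Sigma_p_def Lambda_block_def field_simps)
      also have "\<dots> = (P $ i $ j * g i j * g i j - P $ i $ j * g i j * m i) / \<pi> $ i"
        by (simp add: sum_subtractf flip: sum_divide_distrib sum_distrib_left m_def)
      finally show ?thesis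
        by (simp add: power2_eq_square mult.assoc)
    qed
    then show ?thesis
      by (simp add: sum_subtractf power2_eq_square flip: sum_divide_distrib sum_distrib_right m_def)
  qed
  show ?thesis
    unfolding pairs fst_conv snd_conv left right ..
qed

text \<open>Outside the events that some transition excess exceeds \<open>b sqrt n\<close> or some visit frequency is
  off by \<open>\<delta>\<close>, the scaled error is within \<open>\<epsilon>\<close> of the influence path sum divided by \<open>sqrt n\<close>. The
  probability of the first event is at most \<open>s\<^sup>2 / b\<^sup>2\<close> for \<open>s\<close> states, by the second moment bound, and
  that of the second tends to zero. Hence the two sequences have the same limit law. The arbitrary
  values of the plug-in quantity occur only on the exceptional events.\<close>

lemma plug_in_char_tendsto:
  fixes F :: "real^'s^'s \<Rightarrow> real" and F_hat :: "nat \<Rightarrow> 'a \<Rightarrow> real"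
  assumes irr: "irreducible_matrix P" and stat: "stationary_vector P \<pi>"
    and deriv: "(F has_derivative F') (at P)" and U: "open U" "P \<in> U"
    and meas [measurable]: "\<And>n. F_hat n \<in> borel_measurable M"
    and plug_in: "\<And>n \<omega>. \<omega> \<in> space M \<Longrightarrow> P_hat X n \<omega> \<in> U \<Longrightarrow> stochastic_matrix (P_hat X n \<omega>) \<Longrightarrow>
      F_hat n \<omega> = F (P_hat X n \<omega>)"
  defines "g \<equiv> \<lambda>i j. F' (axis i (axis j 1))"
  shows "(\<lambda>n. \<integral>\<omega>. iexp (t * (sqrt (real n) * (F_hat n \<omega> - F P))) \<partial>M) \<longlonglongrightarrow>
    exp (- (t\<^sup>2 * (\<Sum>p\<in>UNIV. \<Sum>q\<in>UNIV. g (fst p) (snd p) * g (fst q) (snd q) * Sigma_p P \<pi> $ p $ q) / 2))"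
proof -
  have \<pi>: "0 < \<pi> $ i" for i
    by (rule stationary_vector_pos[OF stochastic irr stat])
  let ?Y = "\<lambda>n \<omega>. sqrt (real n) * (F_hat n \<omega> - F P)"
  let ?Z = "\<lambda>n \<omega>. path_sum (influence \<pi> g) n \<omega> / sqrt (real n)"
  let ?E = "\<lambda>n i j \<omega>. path_sum (transition_excess i j) n \<omega>"
  let ?s = "real (CARD('s) * CARD('s))"
  have near: "(\<lambda>n. prob {\<omega> \<in> space M. \<epsilon> \<le> \<bar>?Y n \<omega> - ?Z n \<omega>\<bar>}) \<longlonglongrightarrow> 0" if \<epsilon>: "0 < \<epsilon>" for \<epsilon>
  proof (rule tendstoI)
    fix \<eta> :: real assume \<eta>: "0 < \<eta>"
    obtain b where b: "0 < b" "?s / b\<^sup>2 < \<eta> / 2"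
    proof (rule that[of "sqrt (4 * ?s / \<eta>)"])
      show "0 < sqrt (4 * ?s / \<eta>)" "?s / (sqrt (4 * ?s / \<eta>))\<^sup>2 < \<eta> / 2"
        using \<eta> by simp_all
    qed
    obtain \<delta> n0 where \<delta>: "0 < \<delta>" and small:
      "\<And>(n::nat) Q E \<nu>. n0 \<le> n \<Longrightarrow> (\<And>i. \<bar>\<nu> i / real n - \<pi> $ i\<bar> < \<delta>) \<Longrightarrow>
        (\<And>i j. \<bar>E i j\<bar> \<le> b * sqrt (real n)) \<Longrightarrow> (\<And>i j. 0 < \<nu> i \<Longrightarrow> Q $ i $ j = P $ i $ j + E i j / \<nu> i) \<Longrightarrow>
        (\<forall>i. 0 < \<nu> i) \<and> Q \<in> U \<and>
        \<bar>sqrt (real n) * (F Q - F P) -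
          (\<Sum>i\<in>UNIV. \<Sum>j\<in>UNIV. F' (axis i (axis j 1)) / \<pi> $ i * E i j) / sqrt (real n)\<bar> < \<epsilon>"
    proof (rule delta_remainder_small[OF deriv U \<pi> \<epsilon> b(1)])
      fix \<delta> n0
      assume "0 < \<delta>" and
        "\<And>(n::nat) Q E \<nu>. n0 \<le> n \<Longrightarrow> (\<And>i. \<bar>\<nu> i / real n - \<pi> $ i\<bar> < \<delta>) \<Longrightarrow>
        (\<And>i j. \<bar>E i j\<bar> \<le> b * sqrt (real n)) \<Longrightarrow> (\<And>i j. 0 < \<nu> i \<Longrightarrow> Q $ i $ j = P $ i $ j + E i j / \<nu> i) \<Longrightarrow>
        (\<forall>i. 0 < \<nu> i) \<and> Q \<in> U \<and>
        \<bar>sqrt (real n) * (F Q - F P) -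
          (\<Sum>i\<in>UNIV. \<Sum>j\<in>UNIV. F' (axis i (axis j 1)) / \<pi> $ i * E i j) / sqrt (real n)\<bar> < \<epsilon>"
      then show thesis
        by (rule that[of \<delta> n0])
    qed
    let ?A = "\<lambda>n i j. {\<omega> \<in> space M. b * sqrt (real n) \<le> \<bar>?E n i j \<omega>\<bar>}"
    let ?B = "\<lambda>n i. {\<omega> \<in> space M. \<delta> \<le> \<bar>real (visit_count X n \<omega> i) / real n - \<pi> $ i\<bar>}"
    have bad: "{\<omega> \<in> space M. \<epsilon> \<le> \<bar>?Y n \<omega> - ?Z n \<omega>\<bar>} \<subseteq> (\<Union>p\<in>UNIV. ?A n (fst p) (snd p)) \<union> (\<Union>i\<in>UNIV. ?B n i)"
      if n: "n0 \<le> n" for n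
    proof (rule subsetI, rule ccontr)
      fix \<omega> assume \<omega>: "\<omega> \<in> {\<omega> \<in> space M. \<epsilon> \<le> \<bar>?Y n \<omega> - ?Z n \<omega>\<bar>}"
        and good: "\<omega> \<notin> (\<Union>p\<in>UNIV. ?A n (fst p) (snd p)) \<union> (\<Union>i\<in>UNIV. ?B n i)"
      have E: "\<bar>?E n i j \<omega>\<bar> \<le> b * sqrt (real n)" and \<nu>: "\<bar>real (visit_count X n \<omega> i) / real n - \<pi> $ i\<bar> < \<delta>" for i j
        using good \<omega> by (auto simp: not_le intro: less_imp_le)
      have Q: "P_hat X n \<omega> $ i $ j = P $ i $ j + ?E n i j \<omega> / real (visit_count X n \<omega> i)"
        if "0 < real (visit_count X n \<omega> i)" for i j
        using that by (simp add: P_hat_def path_sum_transition_excess field_simps)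
      have "(\<forall>i. 0 < real (visit_count X n \<omega> i)) \<and> P_hat X n \<omega> \<in> U \<and>
          \<bar>sqrt (real n) * (F (P_hat X n \<omega>) - F P) - ?Z n \<omega>\<bar> < \<epsilon>"
        unfolding path_sum_influence g_def by (rule small) (fact n \<nu> E Q)+
      then have pos: "0 < visit_count X n \<omega> i" and in_U: "P_hat X n \<omega> \<in> U"
        and close: "\<bar>sqrt (real n) * (F (P_hat X n \<omega>) - F P) - ?Z n \<omega>\<bar> < \<epsilon>" for i
        unfolding of_nat_0_less_iff by blast+
      have "F_hat n \<omega> = F (P_hat X n \<omega>)"
        using \<omega> in_U stochastic_P_hat[of X n \<omega>] pos by (intro plug_in) auto
      with close \<omega> show False
        by simp
    qed
    have prob_A: "prob (?A n i j) \<le> 1 / b\<^sup>2" if "0 < n" for n i j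
    proof -
      have "prob (?A n i j) \<le> real n * 1\<^sup>2 / (b * sqrt (real n))\<^sup>2"
        using that b by (intro centred_path_sum_tail centred_transition_excess transition_excess_le_1) simp
      also have "\<dots> = 1 / b\<^sup>2"
        using that b by (simp add: power_mult_distrib)
      finally show ?thesis .
    qed
    have prob_bad: "prob {\<omega> \<in> space M. \<epsilon> \<le> \<bar>?Y n \<omega> - ?Z n \<omega>\<bar>} \<le> ?s / b\<^sup>2 + (\<Sum>i\<in>UNIV. prob (?B n i))"
      if n: "n0 \<le> n" "0 < n" for n
    proof -
      have "prob {\<omega> \<in> space M. \<epsilon> \<le> \<bar>?Y n \<omega> - ?Z n \<omega>\<bar>} \<le>
          prob ((\<Union>p\<in>UNIV. ?A n (fst p) (snd p)) \<union> (\<Union>i\<in>UNIV. ?B n i))"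
        using bad[OF n(1)] by (intro finite_measure_mono) auto
      also have "\<dots> \<le> prob (\<Union>p\<in>UNIV. ?A n (fst p) (snd p)) + prob (\<Union>i\<in>UNIV. ?B n i)"
        by (intro measure_Un_le) auto
      also have "\<dots> \<le> (\<Sum>p\<in>UNIV. prob (?A n (fst p) (snd p))) + (\<Sum>i\<in>UNIV. prob (?B n i))"
        by (intro add_mono measure_UNION_le) auto
      also have "(\<Sum>p\<in>UNIV. prob (?A n (fst p) (snd p))) \<le> (\<Sum>p\<in>(UNIV :: ('s \<times> 's) set). 1 / b\<^sup>2)"
        by (intro sum_mono prob_A n)
      finally show ?thesis
        by (simp add: card_prod)
    qed
    have "(\<lambda>n. \<Sum>i\<in>UNIV. prob (?B n i)) \<longlonglongrightarrow> 0"
      using tendsto_sum[of UNIV "\<lambda>i n. prob (?B n i)" "\<lambda>_. 0"]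
        visit_frequency_tendsto_in_prob[OF irr stat \<delta>] by simp
    then have "eventually (\<lambda>n. (\<Sum>i\<in>UNIV. prob (?B n i)) < \<eta> / 2) sequentially"
      using \<eta> by (intro order_tendstoD) auto
    with eventually_ge_at_top[of n0] eventually_gt_at_top[of "0::nat"]
    show "eventually (\<lambda>n. dist (prob {\<omega> \<in> space M. \<epsilon> \<le> \<bar>?Y n \<omega> - ?Z n \<omega>\<bar>}) 0 < \<eta>) sequentially"
    proof eventually_elim
      case (elim n)
      then have "prob {\<omega> \<in> space M. \<epsilon> \<le> \<bar>?Y n \<omega> - ?Z n \<omega>\<bar>} < \<eta>"
        using prob_bad[of n] b(2) by linarith
      then show ?case
        by simp
    qed
  qed
  have "(\<lambda>n. \<integral>\<omega>. iexp (t * ?Z n \<omega>) \<partial>M) \<longlonglongrightarrow>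
      exp (- (t\<^sup>2 * (\<Sum>p\<in>UNIV. \<Sum>q\<in>UNIV. g (fst p) (snd p) * g (fst q) (snd q) * Sigma_p P \<pi> $ p $ q) / 2))"
    using path_sum_char_tendsto[OF irr stat centred_influence, of t \<pi> g]
    unfolding influence_variance[OF \<pi>] .
  then show ?thesis
    by (intro char_tendsto_perturb[OF _ _ near]) measurable
qed

end

section \<open>Vectorization and the limit theorem\<close>

lemma vec_of_transpose_nth: "vec_of (transpose A) $ (i, j) = A $ i $ j"
  by (simp add: vec_of_def transpose_def)

lemma W_p_nth: "W_p W \<omega> $ p = W \<omega> $ fst p $ snd p"
  by (simp add: W_p_def vec_of_def transpose_def)

lemma sum_pair_UNIV: "(\<Sum>p\<in>UNIV. f p) = (\<Sum>i\<in>(UNIV::'a::finite set). \<Sum>j\<in>(UNIV::'b::finite set). f (i, j))"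
  using sum.cartesian_product[of "\<lambda>i j. f (i, j)" UNIV UNIV] by simp

text \<open>The usual identity \<open>vec (B H A) = (A\<^sup>T \<otimes> B) vec H\<close>, with the Kronecker factors interchanged
  because \<open>vec\<close> of the transpose stacks rows.\<close>

lemma vec_of_sandwich:
  fixes B :: "real^'s::finite^'q::finite" and A :: "real^'r::finite^'t::finite" and H :: "real^'t^'s"
  shows "vec_of (transpose (B ** H ** A)) = kronecker B (transpose A) *v vec_of (transpose H)"
proof -
  have "(B ** H ** A) $ k $ l =
      (\<Sum>i\<in>UNIV. \<Sum>j\<in>UNIV. B $ k $ i * A $ j $ l * H $ i $ j)" for k l
    by (subst sum.swap) (simp add: matrix_matrix_mult_def sum_distrib_left sum_distrib_right mult_ac)
  then show ?thesis
    by (simp add: vec_eq_iff split_paired_all vec_of_transpose_nth matrix_vector_mult_def sum_pair_UNIV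
        kronecker_def transpose_def[of A] mult_ac)
qed

text \<open>Every vector is a vectorized matrix, which is why a linear map on matrices determines its
  representing matrix \<open>L\<close>.\<close>

lemma matrix_eq_if_vec_of_eq:
  fixes K L :: "real^('s::finite \<times> 't::finite)^'m::finite"
  assumes "\<And>H :: real^'t^'s. K *v vec_of (transpose H) = L *v vec_of (transpose H)"
  shows "K = L"
proof -
  have "K *v x = L *v x" for x
  proof -
    have "x = vec_of (transpose (\<chi> i j. x $ (i, j)))"
      by (simp add: vec_eq_iff split_paired_all vec_of_transpose_nth)
    then show ?thesis
      using assms by metis
  qed
  then show ?thesis
    by (simp add: matrix_eq)
qed

lemma transpose_kronecker: "transpose (kronecker A B) = kronecker (transpose A) (transpose B)"
  by (simp add: kronecker_def transpose_def)

theorem proposition2: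
  fixes M :: "'a measure" and X :: "nat \<Rightarrow> 'a \<Rightarrow> 's::finite"
    and P :: "real^'s^'s" and \<pi> :: "real^'s"
    and N :: "'b measure" and W :: "'b \<Rightarrow> real^'s^'s"
    and U :: "(real^'s^'s) set"
    and \<Phi> :: "real^'s^'s \<Rightarrow> real^'r^'q" and \<Phi>' :: "real^'s^'s \<Rightarrow> real^'r^'q"
    and L :: "real^('s \<times> 's)^('q \<times> 'r)"
  assumes "stochastic_matrix P" and "irreducible_matrix P"
    and "stationary_vector P \<pi>"
    and "markov_chain M P X"
    and "limit_gaussian_matrix N P \<pi> W"
    and "open U" and "P \<in> U"
    and "(\<Phi> has_derivative \<Phi>') (at P within U)"
    and "\<forall>H. vec_of (transpose (\<Phi>' H)) = L *v vec_of (transpose H)"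
  shows "(\<forall>\<omega>\<in>space N. vec_of (transpose (\<Phi>' (W \<omega>))) = L *v W_p W \<omega>)
    \<and> covariance_matrix N (\<lambda>\<omega>. vec_of (transpose (\<Phi>' (W \<omega>)))) = L ** Sigma_p P \<pi> ** transpose L
    \<and> (\<forall>(m::nat) (B :: nat \<Rightarrow> real^'s^'q) (A :: nat \<Rightarrow> real^'r^'s).
         (\<forall>H. \<Phi>' H = (\<Sum>l=1..m. B l ** H ** A l)) \<longrightarrow>
         L = (\<Sum>l=1..m. kronecker (B l) (transpose (A l))))
    \<and> (\<forall>(a :: real^'q^1) (c :: real^1^'r) (\<phi>_hat :: nat \<Rightarrow> 'a \<Rightarrow> real).
         (\<forall>n. \<phi>_hat n \<in> borel_measurable M) \<and>
         (\<forall>n. \<forall>\<omega>\<in>space M. P_hat X n \<omega> \<in> U \<and> stochastic_matrix (P_hat X n \<omega>) \<longrightarrow>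
            \<phi>_hat n \<omega> = (a ** \<Phi> (P_hat X n \<omega>) ** c) $ 1 $ 1) \<longrightarrow>
         weak_conv_m
           (\<lambda>n. distr M borel (\<lambda>\<omega>. sqrt (real n) * (\<phi>_hat n \<omega> - (a ** \<Phi> P ** c) $ 1 $ 1)))
           (distr N borel (\<lambda>\<omega>. (a ** \<Phi>' (W \<omega>) ** c) $ 1 $ 1))
         \<and> prob_space.variance N (\<lambda>\<omega>. (a ** \<Phi>' (W \<omega>) ** c) $ 1 $ 1) =
           (kronecker a (transpose c) ** L ** Sigma_p P \<pi> ** transpose L
              ** kronecker (transpose a) c) $ (1, 1) $ (1, 1))"
proof -
  have gauss: "gaussian_element N W" and W_mean: "\<And>i j. (\<integral>\<omega>. W \<omega> $ i $ j \<partial>N) = 0"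
    using assms(5) by (auto simp: limit_gaussian_matrix_def)
  have N: "prob_space N" and W_meas [measurable]: "W \<in> borel_measurable N"
    using gauss by (auto simp: gaussian_element_def)
  have \<Phi>'_vec: "vec_of (transpose (\<Phi>' (W \<omega>))) = L *v W_p W \<omega>" for \<omega>
    using assms(9) by (simp add: W_p_def)
  have W_p_int: "integrable N (\<lambda>\<omega>. W_p W \<omega> $ p)" "integrable N (\<lambda>\<omega>. (W_p W \<omega> $ p)\<^sup>2)" for p
    using gaussian_element_square_integrable[OF gauss, of "axis (fst p) (axis (snd p) 1)"]
    by (simp_all add: W_p_nth inner_axis')
  have cov_linear: "covariance_matrix N (\<lambda>\<omega>. K *v W_p W \<omega>) = K ** Sigma_p P \<pi> ** transpose K"
    for K :: "real^('s \<times> 's)^'x::finite"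
    using covariance_matrix_linear_image[OF N W_p_int] covariance_matrix_W_p[OF assms(5)] by simp
  have kron: "L = (\<Sum>l=1..m. kronecker (B l) (transpose (A l)))"
    if \<Phi>': "\<forall>H. \<Phi>' H = (\<Sum>l=1..m. B l ** H ** A l)"
    for m and B :: "nat \<Rightarrow> real^'s^'q" and A :: "nat \<Rightarrow> real^'r^'s"
  proof (rule matrix_eq_if_vec_of_eq)
    fix H :: "real^'s^'s"
    have "L *v vec_of (transpose H) = vec_of (transpose (\<Sum>l=1..m. B l ** H ** A l))"
      using assms(9) \<Phi>' by metis
    also have "\<dots> = (\<Sum>l=1..m. vec_of (transpose (B l ** H ** A l)))"
      by (simp add: vec_eq_iff split_paired_all vec_of_transpose_nth)
    also have "\<dots> = (\<Sum>l=1..m. kronecker (B l) (transpose (A l)) *v vec_of (transpose H))"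
      by (simp only: vec_of_sandwich)
    also have "\<dots> = (\<Sum>l=1..m. kronecker (B l) (transpose (A l))) *v vec_of (transpose H)"
      by (induction m) (simp_all add: matrix_vector_mult_add_rdistrib)
    finally show "L *v vec_of (transpose H) = (\<Sum>l=1..m. kronecker (B l) (transpose (A l))) *v vec_of (transpose H)" .
  qed
  have clt: "weak_conv_m
      (\<lambda>n. distr M borel (\<lambda>\<omega>. sqrt (real n) * (\<phi>_hat n \<omega> - (a ** \<Phi> P ** c) $ 1 $ 1)))
      (distr N borel (\<lambda>\<omega>. (a ** \<Phi>' (W \<omega>) ** c) $ 1 $ 1)) \<and>
    prob_space.variance N (\<lambda>\<omega>. (a ** \<Phi>' (W \<omega>) ** c) $ 1 $ 1) =
      (kronecker a (transpose c) ** L ** Sigma_p P \<pi> ** transpose L ** kronecker (transpose a) c) $ (1, 1) $ (1, 1)"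
    if meas: "\<And>n. \<phi>_hat n \<in> borel_measurable M"
      and plug_in: "\<And>n \<omega>. \<omega> \<in> space M \<Longrightarrow> P_hat X n \<omega> \<in> U \<Longrightarrow> stochastic_matrix (P_hat X n \<omega>) \<Longrightarrow>
        \<phi>_hat n \<omega> = (a ** \<Phi> (P_hat X n \<omega>) ** c) $ 1 $ 1"
    for a :: "real^'q^1" and c :: "real^1^'r" and \<phi>_hat :: "nat \<Rightarrow> 'a \<Rightarrow> real"
  proof
    interpret M: markov_trajectory M P X
      using assms(1,4) by (auto simp: markov_trajectory_def markov_trajectory_axioms_def markov_chain_def)
    interpret N: prob_space N by fact
    note [measurable] = meas
    define K where "K = kronecker a (transpose c)"
    define F where "F A = (a ** \<Phi> A ** c) $ 1 $ 1" for A
    define F' where "F' H = (a ** \<Phi>' H ** c) $ 1 $ 1" for H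
    define g where "g i j = F' (axis i (axis j 1))" for i j
    define V where "V \<omega> = F' (W \<omega>)" for \<omega>
    have "linear (\<lambda>B :: real^'r^'q. (a ** B ** c) $ 1 $ 1)"
      by (intro linearI)
        (simp_all add: matrix_matrix_mult_def sum_distrib_left sum_distrib_right sum.distrib algebra_simps)
    then have "bounded_linear (\<lambda>B :: real^'r^'q. (a ** B ** c) $ 1 $ 1)"
      by (simp add: linear_conv_bounded_linear)
    then have "((\<lambda>A. (a ** \<Phi> A ** c) $ 1 $ 1) has_derivative (\<lambda>H. (a ** \<Phi>' H ** c) $ 1 $ 1)) (at P within U)"
      using assms(8) by (rule bounded_linear.has_derivative)
    then have deriv: "(F has_derivative F') (at P)"
      using at_within_open[OF assms(7,6)] by (simp add: F_def[abs_def] F'_def[abs_def])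
    \<comment> \<open>The limit variable is written in two ways: as an entry of a linear image of \<open>W_p\<close>, which gives
      the Kronecker form of its variance, and as a combination of the entries of \<open>W\<close> with
      coefficients \<open>g\<close>, which shows that it is Gaussian and matches the trajectory variance.\<close>
    have V_K: "V \<omega> = ((K ** L) *v W_p W \<omega>) $ (1, 1)" for \<omega>
    proof -
      have "V \<omega> = vec_of (transpose (a ** \<Phi>' (W \<omega>) ** c)) $ (1, 1)"
        by (simp only: V_def F'_def vec_of_transpose_nth)
      then show ?thesis
        by (simp only: vec_of_sandwich K_def \<Phi>'_vec matrix_vector_mul_assoc)
    qed
    have variance_K: "N.variance V = (K ** L ** Sigma_p P \<pi> ** transpose (K ** L)) $ (1, 1) $ (1, 1)"
      unfolding cov_linear[symmetric]
      by (simp add: covariance_matrix_def covariance_def V_K[abs_def] power2_eq_square)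
    then show "N.variance (\<lambda>\<omega>. (a ** \<Phi>' (W \<omega>) ** c) $ 1 $ 1) =
        (kronecker a (transpose c) ** L ** Sigma_p P \<pi> ** transpose L ** kronecker (transpose a) c) $ (1, 1) $ (1, 1)"
      by (simp add: V_def[abs_def] F'_def K_def matrix_transpose_mul transpose_kronecker matrix_mul_assoc)
    have V_sum: "V \<omega> = (\<Sum>p\<in>UNIV. g (fst p) (snd p) * W_p W \<omega> $ p)" for \<omega>
      using linear_matrix_functional[OF has_derivative_linear[OF deriv], of "W \<omega>"]
      by (simp add: V_def g_def sum_pair_UNIV W_p_nth)
    have variance_g: "N.variance V =
        (\<Sum>p\<in>UNIV. \<Sum>q\<in>UNIV. g (fst p) (snd p) * g (fst q) (snd q) * Sigma_p P \<pi> $ p $ q)"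
    proof -
      have "N.variance V = covariance N V V"
        by (simp add: covariance_def power2_eq_square)
      also have "\<dots> = (\<Sum>p\<in>UNIV. \<Sum>q\<in>UNIV. g (fst p) (snd p) * g (fst q) (snd q) *
          covariance N (\<lambda>\<omega>. W_p W \<omega> $ p) (\<lambda>\<omega>. W_p W \<omega> $ q))"
        unfolding V_sum[abs_def] by (rule covariance_sum[OF N]) (simp_all add: W_p_int)
      finally show ?thesis
        by (simp add: covariance_matrix_def flip: covariance_matrix_W_p[OF assms(5)])
    qed
    have V_inner: "V \<omega> = (\<chi> i j. g i j) \<bullet> W \<omega>" for \<omega>
      by (simp add: V_sum sum_pair_UNIV W_p_nth inner_vec_def)
    have [measurable]: "V \<in> borel_measurable N"
      unfolding V_inner[abs_def] by measurable
    obtain \<mu> \<sigma> where law: "0 \<le> \<sigma>" "distr N borel V = gaussian_law \<mu> \<sigma>"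
      using gauss unfolding gaussian_element_def V_inner[abs_def] by blast
    note moments = gaussian_law_moments[OF N \<open>V \<in> borel_measurable N\<close> law]
    have "N.expectation V = 0"
      unfolding V_sum[abs_def] using W_p_int(1)
      by (subst Bochner_Integration.integral_sum) (auto simp: W_p_nth W_mean)
    then have "\<mu> = 0" "\<sigma>\<^sup>2 = N.variance V"
      using moments(3,4) by simp_all
    then have char_V: "N.expectation (\<lambda>\<omega>. iexp (t * V \<omega>)) = exp (- (t\<^sup>2 * N.variance V / 2))" for t
      using moments(5)[of t] by simp
    have "weak_conv_m (\<lambda>n. distr M borel (\<lambda>\<omega>. sqrt (real n) * (\<phi>_hat n \<omega> - F P))) (distr N borel V)"
    proof (rule levy_continuity)
      show "real_distribution (distr M borel (\<lambda>\<omega>. sqrt (real n) * (\<phi>_hat n \<omega> - F P)))" for n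
        by (rule M.real_distribution_distr) measurable
      show "real_distribution (distr N borel V)"
        by (rule N.real_distribution_distr) measurable
      fix t
      have "(\<lambda>n. M.expectation (\<lambda>\<omega>. iexp (t * (sqrt (real n) * (\<phi>_hat n \<omega> - F P))))) \<longlonglongrightarrow>
          exp (- (t\<^sup>2 * N.variance V / 2))"
        unfolding variance_g g_def
        by (rule M.plug_in_char_tendsto[OF assms(2,3) deriv assms(6,7) meas])
          (simp add: plug_in F_def)
      moreover have "char (distr M borel (\<lambda>\<omega>. sqrt (real n) * (\<phi>_hat n \<omega> - F P))) t =
          M.expectation (\<lambda>\<omega>. iexp (t * (sqrt (real n) * (\<phi>_hat n \<omega> - F P))))" for n
        unfolding char_def by (rule integral_distr) measurable
      moreover have "char (distr N borel V) t = N.expectation (\<lambda>\<omega>. iexp (t * V \<omega>))"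
        unfolding char_def by (rule integral_distr) measurable
      ultimately show "(\<lambda>n. char (distr M borel (\<lambda>\<omega>. sqrt (real n) * (\<phi>_hat n \<omega> - F P))) t) \<longlonglongrightarrow>
          char (distr N borel V) t"
        by (simp only: char_V)
    qed
    then show "weak_conv_m
      (\<lambda>n. distr M borel (\<lambda>\<omega>. sqrt (real n) * (\<phi>_hat n \<omega> - (a ** \<Phi> P ** c) $ 1 $ 1)))
      (distr N borel (\<lambda>\<omega>. (a ** \<Phi>' (W \<omega>) ** c) $ 1 $ 1))"
      by (simp add: F_def F'_def V_def[abs_def])
  qed
  have cov: "covariance_matrix N (\<lambda>\<omega>. vec_of (transpose (\<Phi>' (W \<omega>)))) = L ** Sigma_p P \<pi> ** transpose L"
    unfolding \<Phi>'_vec by (rule cov_linear)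
  show ?thesis
    by (intro conjI[OF _ conjI[OF cov conjI]] allI impI ballI; (rule \<Phi>'_vec | erule kron | (rule clt; blast)))
qed

end
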